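(* (Semimagic) The quad codes of length 16 containing $C_s$ have dimensions between 7 and 11, and the number of them of dimension $7,8,9,10,11$ is $1,159,2531,2823,112$ respectively. (Magic) The quad codes of length 16 containing $C_m$ have dimensions between 8 and 11, and the number of them of dimension $8,9,10,11$ is $1,43,85,10$ respectively. (Strongly magic) There is exactly one quad code of length 16 containing $C_{sm}$, and it has dimension 11. Moreover, a quad code of length 16 and dimension $k\in\{7,8,9,10,11\}$ of any of these three kinds is realizable in the EvenQuads-$2^n$ deck exactly when $n\ge 15-k$; so the smallest deck realizing it has size $256,128,64,32,16$ for $k=7,8,9,10,11$ respectively.
   Context: The EvenQuads-$2^n$ deck is $\mathbb{Z}_2^n$; its elements are cards. A quad code of length $\ell$ is a linear subspace of $\mathbb{Z}_2^\ell$ in which every codeword has an even number of ones and every nonzero codeword has at least 4 ones. A sequence of pairwise distinct cards $\vec a_1,\dots,\vec a_\ell$ realizes the code $\{c\in\mathbb{Z}_2^\ell:\ c \text{ has an even number of ones},\ \sum_i c_i\vec a_i=\vec 0\}$; a code is realizable in the EvenQuads-$2^n$ deck if some such sequence in $\mathbb{Z}_2^n$ realizes it. Index the 16 positions of a $4\times4$ square by $1,\dots,16$ left-to-right, top-to-bottom. $C_s$ is the subspace of $\mathbb{Z}_2^{16}$ spanned by the four row words $1111000000000000$, $0000111100000000$, $0000000011110000$, $0000000000001111$ and the four column words $1000100010001000$, $0100010001000100$, $0010001000100010$, $0001000100010001$ (it has dimension 7); these are the codes of $4\times 4$ card arrangements in which every row and column is a quad (semimagic quad squares). $C_m$ is spanned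 by $C_s$ together with the diagonal words $1000010000100001$ and $0001001001001000$ (dimension 8; magic quad squares). For $C_{sm}$, identify the position in row $r$ and column $c$ ($r,c\in\{0,1,2,3\}$) with the vector $(\beta(r),\beta(c))\in\mathbb{Z}_2^2\times\mathbb{Z}_2^2=\mathbb{Z}_2^4$, where $\beta$ is the 2-bit binary representation; $C_{sm}$ is the subspace spanned by the indicator vectors of all sets of four distinct positions whose vectors sum to $\vec 0$ (dimension 11; strongly magic quad squares). *)

theory Defs
  imports
    Complex_Main
    "HOL-Library.Z2"
    "HOL-Library.Function_Algebras"
    "HOL-Library.Product_Plus"
    "HOL-Library.Indicator_Function"
begin

(* Z_2^n is the set of sequences over the two-element field that vanish from index n on.
   Coordinates are counted from 0, so the i-th coordinate of a word is its value at i - 1. *)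

definition Z2_pow :: "nat \<Rightarrow> (nat \<Rightarrow> bit) set" where
  "Z2_pow n = {v. \<forall>i\<ge>n. v i = 0}"

definition scale_Z2 :: "bit \<Rightarrow> (nat \<Rightarrow> bit) \<Rightarrow> (nat \<Rightarrow> bit)" where
  "scale_Z2 a v = (\<lambda>i. a * v i)"

global_interpretation Z2v: vector_space scale_Z2
  by standard (auto simp: scale_Z2_def fun_eq_iff algebra_simps)

definition weight :: "(nat \<Rightarrow> bit) \<Rightarrow> nat" where
  "weight c = card {i. c i = 1}"

definition quad_code :: "nat \<Rightarrow> (nat \<Rightarrow> bit) set \<Rightarrow> bool" where
  "quad_code l C \<longleftrightarrow> C \<subseteq> Z2_pow l \<and> Z2v.subspace C \<and>
     (\<forall>c\<in>C. even (weight c)) \<and> (\<forall>c\<in>C. c \<noteq> 0 \<longrightarrow> 4 \<le> weight c)"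

definition deck :: "nat \<Rightarrow> (nat \<Rightarrow> bit) set" where
  "deck n = Z2_pow n"

definition realized_code :: "(nat \<Rightarrow> bit) list \<Rightarrow> (nat \<Rightarrow> bit) set" where
  "realized_code as = {c \<in> Z2_pow (length as).
     even (weight c) \<and> (\<Sum>i<length as. scale_Z2 (c i) (as ! i)) = 0}"

definition realizable :: "nat \<Rightarrow> nat \<Rightarrow> (nat \<Rightarrow> bit) set \<Rightarrow> bool" where
  "realizable n l C \<longleftrightarrow>
     (\<exists>as. length as = l \<and> set as \<subseteq> deck n \<and> distinct as \<and> realized_code as = C)"

definition smallest_deck_size :: "nat \<Rightarrow> (nat \<Rightarrow> bit) set \<Rightarrow> nat" where
  "smallest_deck_size l C = (LEAST s. \<exists>n. s = card (deck n) \<and> realizable n l C)"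

definition word :: "bit list \<Rightarrow> (nat \<Rightarrow> bit)" where
  "word bs = (\<lambda>i. if i < length bs then bs ! i else 0)"

definition row_words :: "(nat \<Rightarrow> bit) set" where
  "row_words =
    {word [1,1,1,1, 0,0,0,0, 0,0,0,0, 0,0,0,0],
     word [0,0,0,0, 1,1,1,1, 0,0,0,0, 0,0,0,0],
     word [0,0,0,0, 0,0,0,0, 1,1,1,1, 0,0,0,0],
     word [0,0,0,0, 0,0,0,0, 0,0,0,0, 1,1,1,1]}"

definition column_words :: "(nat \<Rightarrow> bit) set" where
  "column_words =
    {word [1,0,0,0, 1,0,0,0, 1,0,0,0, 1,0,0,0],
     word [0,1,0,0, 0,1,0,0, 0,1,0,0, 0,1,0,0],
     word [0,0,1,0, 0,0,1,0, 0,0,1,0, 0,0,1,0],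
     word [0,0,0,1, 0,0,0,1, 0,0,0,1, 0,0,0,1]}"

definition diagonal_words :: "(nat \<Rightarrow> bit) set" where
  "diagonal_words =
    {word [1,0,0,0, 0,1,0,0, 0,0,1,0, 0,0,0,1],
     word [0,0,0,1, 0,0,1,0, 0,1,0,0, 1,0,0,0]}"

definition C_s :: "(nat \<Rightarrow> bit) set" where
  "C_s = Z2v.span (row_words \<union> column_words)"

definition C_m :: "(nat \<Rightarrow> bit) set" where
  "C_m = Z2v.span (C_s \<union> diagonal_words)"

(* The two binary digits of r \<in> {0,1,2,3}; of_nat into the two-element field reduces mod 2. *)
definition two_bits :: "nat \<Rightarrow> bit \<times> bit" where
  "two_bits r = (of_nat (r div 2), of_nat (r mod 2))"

(* Position p < 16 lies in row p div 4 and column p mod 4 of the square. *)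
definition position_vector :: "nat \<Rightarrow> (bit \<times> bit) \<times> (bit \<times> bit)" where
  "position_vector p = (two_bits (p div 4), two_bits (p mod 4))"

definition C_sm :: "(nat \<Rightarrow> bit) set" where
  "C_sm = Z2v.span
     {indicator Q |Q. Q \<subseteq> {..<16} \<and> card Q = 4 \<and> (\<Sum>p\<in>Q. position_vector p) = 0}"

definition num_quad_codes_above :: "(nat \<Rightarrow> bit) set \<Rightarrow> nat \<Rightarrow> nat" where
  "num_quad_codes_above B k = card {C. quad_code 16 C \<and> B \<subseteq> C \<and> Z2v.dim C = k}"

end

(* Every word x of length 16, read as a 4 x 4 matrix, is sent to the 3 x 3 matrix with entries
   x(r,c) + x(r,0) + x(3,c) + x(3,0) for r < 3 and c > 0.  This map preserves the parity of the weight
   and its kernel is C_s, so the quad codes of dimension d + 7 above C_s correspond to the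
   d-dimensional subspaces of Z_2^9 whose nonzero vectors avoid the words of odd weight and the
   images of the words of weight 2.  The two diagonal words have the same image t, so a code contains
   C_m iff its subspace contains t.

   To count the d-dimensional subspaces U of Z_2^(n+1) inside a set G of good vectors, count the pairs
   of such a U, not contained in Z_2^n, and a vector v of U with last coordinate 1: each U has
   2^(d-1) such v, and U is determined by v and U \<inter> Z_2^n, a (d-1)-dimensional subspace of Z_2^n
   inside G \<inter> (G + v).  The resulting recursion is evaluated on sets represented as binary tries.

   C_sm is the code of all even words whose positions sum to 0, since adding a quad that shares three
   positions with a nonzero such word lowers its weight.  Finally, a quad code C of length l is the
   kernel of a linear map on the even words whose image has dimension l - 1 - dim C, and the cards are
   the images of e_i + e_0. *)

theory Submission
  imports Defs
begin

section \<open>Subspaces over the two-element field\<close>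

lemma scale_Z2_simps [simp]: "scale_Z2 0 x = 0" "scale_Z2 1 x = x"
  by (auto simp: scale_Z2_def)

lemma Z2_subspace_iff:
  "Z2v.subspace S \<longleftrightarrow> 0 \<in> S \<and> (\<forall>x\<in>S. \<forall>y\<in>S. x + y \<in> S)"
proof -
  have "scale_Z2 a x \<in> S" if "0 \<in> S" "x \<in> S" for a x
    using that by (cases a) simp_all
  then show ?thesis
    by (auto simp: Z2v.subspace_def)
qed

lemma word_add_self [simp]: "(x :: nat \<Rightarrow> bit) + x = 0"
  by (auto simp: fun_eq_iff)

lemma word_add_left_self [simp]: "(x :: nat \<Rightarrow> bit) + (x + y) = y"
  by (simp add: add.assoc [symmetric])

lemma word_add_right_self: "(x :: nat \<Rightarrow> bit) + y + y = x"
  by (auto simp: fun_eq_iff)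

lemma word_diff [simp]: "(x :: nat \<Rightarrow> bit) - y = x + y"
  by (auto simp: fun_eq_iff)

lemma word_add_eq_0_iff: "(x :: nat \<Rightarrow> bit) + y = 0 \<longleftrightarrow> x = y"
  by (metis word_add_left_self add.right_neutral word_add_self)

lemma subspace_Z2_pow: "Z2v.subspace (Z2_pow n)"
  by (auto simp: Z2_subspace_iff Z2_pow_def)

lemma Z2_pow_add: "x \<in> Z2_pow n \<Longrightarrow> y \<in> Z2_pow n \<Longrightarrow> x + y \<in> Z2_pow n"
  by (auto simp: Z2_pow_def)

lemma zero_in_Z2_pow [simp]: "0 \<in> Z2_pow n"
  by (auto simp: Z2_pow_def)

lemma Z2_pow_0 [simp]: "Z2_pow 0 = {0}"
  by (auto simp: Z2_pow_def)

lemma bij_betw_Pow_Z2_pow: "bij_betw (\<lambda>A i. of_bool (i \<in> A)) (Pow {..<n}) (Z2_pow n)"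
proof (rule bij_betw_byWitness [where f' = "\<lambda>v. {i. v i = 1}"])
  show "\<forall>v\<in>Z2_pow n. (\<lambda>i. of_bool (i \<in> {i. v i = 1})) = v"
    by (auto simp: fun_eq_iff)
  show "(\<lambda>v. {i. v i = 1}) ` Z2_pow n \<subseteq> Pow {..<n}"
    by (auto simp: Z2_pow_def) (metis bit_not_one_iff not_le)
qed (auto simp: Z2_pow_def)

lemma finite_Z2_pow [simp]: "finite (Z2_pow n)"
  using bij_betw_finite [OF bij_betw_Pow_Z2_pow] by simp

lemma card_Z2_pow: "card (Z2_pow n) = 2 ^ n"
  using bij_betw_same_card [OF bij_betw_Pow_Z2_pow [of n]] by (simp add: card_Pow)

lemma card_Un_translate:
  assumes "Z2v.subspace S" "finite S" "t \<notin> S"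
  shows "card (S \<union> (+) t ` S) = 2 * card S"
proof -
  have "S \<inter> (+) t ` S = {}"
    using assms by (auto simp: Z2_subspace_iff)
      (metis add.commute word_add_left_self)
  moreover have "card ((+) t ` S) = card S"
    by (intro card_image) (auto simp: inj_on_def)
  ultimately show ?thesis
    using assms by (simp add: card_Un_disjoint)
qed

lemma subspace_Un_translate:
  assumes "Z2v.subspace S"
  shows "Z2v.subspace (S \<union> (+) t ` S)"
proof -
  have "(t + x) + (t + y) = x + y" for x y :: "nat \<Rightarrow> bit"
    by (simp add: ac_simps)
  then show ?thesis
    using assms by (auto simp: Z2_subspace_iff image_iff add.left_commute add.assoc)
qed

text \<open>The only scalars are 0 and 1, so a new generator is used at most once and the span gains
  a single translate.\<close>

lemma span_insert_Z2: "Z2v.span (insert t B) = Z2v.span B \<union> (+) t ` Z2v.span B"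
proof (intro set_eqI)
  fix x
  have "(\<exists>k. P k) \<longleftrightarrow> P 0 \<or> P 1" for P :: "bit \<Rightarrow> bool"
    by (metis bit_not_one_iff)
  moreover have "x + t \<in> Z2v.span B \<longleftrightarrow> x \<in> (+) t ` Z2v.span B"
    by (metis (no_types, lifting) add.commute image_iff word_add_left_self)
  ultimately show "x \<in> Z2v.span (insert t B) \<longleftrightarrow> x \<in> Z2v.span B \<union> (+) t ` Z2v.span B"
    by (simp add: Z2v.span_breakdown_eq)
qed

lemma card_span_independent:
  assumes "finite B" "Z2v.independent B"
  shows "finite (Z2v.span B) \<and> card (Z2v.span B) = 2 ^ card B"
  using assms
proof (induction B rule: finite_induct)
  case empty
  then show ?case by simp
next
  case (insert t B)
  then have "Z2v.independent B" "t \<notin> Z2v.span B"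
    by (auto simp: Z2v.independent_insert)
  with insert show ?case
    by (simp add: span_insert_Z2 card_Un_translate)
qed

text \<open>Each basis vector doubles the span. Dimensions are compared below by comparing
  cardinalities.\<close>

lemma card_subspace:
  assumes "Z2v.subspace S" "finite S"
  shows "card S = 2 ^ Z2v.dim S"
proof -
  obtain B where B: "B \<subseteq> S" "Z2v.independent B" "S \<subseteq> Z2v.span B" "card B = Z2v.dim S"
    using Z2v.basis_exists by blast
  then have "Z2v.span B = S"
    using assms(1) by (simp add: Z2v.span_minimal subset_antisym)
  with B assms(2) show ?thesis
    using card_span_independent [of B] finite_subset by auto
qed

lemma card_subspace_of_Z2_pow:
  assumes "Z2v.subspace S" "S \<subseteq> Z2_pow n"
  shows "card S = 2 ^ Z2v.dim S"
  using assms card_subspace finite_subset finite_Z2_pow by blast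

section \<open>Subspaces within a prescribed set, split by the last coordinate\<close>

lemma subspace_eq_Un_translate:
  assumes "Z2v.subspace U" "t \<in> U" "t n = 1"
  shows "{u \<in> U. u n = 1} = (+) t ` {u \<in> U. u n = 0}"
proof (intro equalityI subsetI)
  fix u assume "u \<in> {u \<in> U. u n = 1}"
  with assms have "t + u \<in> {u \<in> U. u n = 0}" "u = t + (t + u)"
    by (auto simp: Z2_subspace_iff)
  then show "u \<in> (+) t ` {u \<in> U. u n = 0}"
    by blast
qed (use assms in \<open>auto simp: Z2_subspace_iff\<close>)

lemma Z2_pow_Suc_Int: "U \<subseteq> Z2_pow (Suc n) \<Longrightarrow> U \<inter> Z2_pow n = {u \<in> U. u n = 0}"
  by (auto simp: Z2_pow_def subset_iff) (metis le_antisym not_less_eq_eq)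

text \<open>The zero vector is exempt, so \<open>G\<close> need not contain it.\<close>

definition subspaces_in :: "nat \<Rightarrow> (nat \<Rightarrow> bit) set \<Rightarrow> nat \<Rightarrow> (nat \<Rightarrow> bit) set set" where
  "subspaces_in n G d =
    {U. Z2v.subspace U \<and> U \<subseteq> Z2_pow n \<and> U - {0} \<subseteq> G \<and> Z2v.dim U = d}"

lemma finite_subspaces_in [simp]: "finite (subspaces_in n G d)"
  by (rule finite_subset [of _ "Pow (Z2_pow n)"]) (auto simp: subspaces_in_def)

lemma subspaces_in_cong:
  "G \<inter> Z2_pow n = H \<inter> Z2_pow n \<Longrightarrow> subspaces_in n G d = subspaces_in n H d"
  unfolding subspaces_in_def by blast

lemma zero_subspace: "Z2v.subspace U \<Longrightarrow> 0 \<in> U"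
  by (simp add: Z2v.subspace_0)

lemma subspaces_in_0: "subspaces_in n G 0 = {{0}}"
proof -
  have "U = {0}" if "Z2v.subspace U" "U \<subseteq> Z2_pow n" "Z2v.dim U = 0" for U
    using card_subspace_of_Z2_pow [OF that(1,2)] that zero_subspace [OF that(1)]
    by (auto simp: card_1_singleton_iff)
  moreover have "Z2v.dim {0} = 0"
    using Z2v.dim_le_card [of "{0}" "{}"] by simp
  ultimately show ?thesis
    by (auto simp: subspaces_in_def)
qed

lemma subspaces_in_empty: "G \<inter> Z2_pow n \<subseteq> {0} \<Longrightarrow> subspaces_in n G (Suc d) = {}"
proof -
  assume G: "G \<inter> Z2_pow n \<subseteq> {0}"
  have "Z2v.dim U = 0" if "U \<subseteq> Z2_pow n" "U - {0} \<subseteq> G" for U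
    using that G Z2v.dim_le_card [of U "{}"] by force
  then show ?thesis
    by (fastforce simp: subspaces_in_def)
qed

text \<open>The half of \<open>U\<close> with last coordinate 1 is \<open>t\<close> plus the half
  \<open>W\<close> with last coordinate 0, so \<open>U\<close> and \<open>W\<close> determine each
  other. All vectors \<open>u + t\<close> with \<open>u \<in> W\<close> are nonzero and hence must
  lie in \<open>G\<close>; for \<open>u = 0\<close> this is the assumption
  \<open>t \<in> G\<close>.\<close>

lemma bij_betw_subspaces_through:
  assumes t: "t \<in> Z2_pow (Suc n)" "t n = 1" "t \<in> G"
  shows "bij_betw (\<lambda>U. U \<inter> Z2_pow n) {U \<in> subspaces_in (Suc n) G (Suc d). t \<in> U}
           (subspaces_in n (G \<inter> {u. u + t \<in> G}) d)"
proof (rule bij_betw_byWitness [where f' = "\<lambda>W. W \<union> (+) t ` W"])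
  have t': "t \<notin> Z2_pow n"
    using t by (auto simp: Z2_pow_def)
  have split: "(U \<inter> Z2_pow n) \<union> (+) t ` (U \<inter> Z2_pow n) = U"
    if "U \<in> subspaces_in (Suc n) G (Suc d)" "t \<in> U" for U
  proof -
    have U: "Z2v.subspace U" "U \<subseteq> Z2_pow (Suc n)"
      using that by (auto simp: subspaces_in_def)
    have "U = {u \<in> U. u n = 0} \<union> {u \<in> U. u n = 1}"
      by (auto simp: bit_not_one_iff)
    then show ?thesis
      using subspace_eq_Un_translate [OF U(1) that(2) t(2)] Z2_pow_Suc_Int [OF U(2)] by simp
  qed
  then show "\<forall>U\<in>{U \<in> subspaces_in (Suc n) G (Suc d). t \<in> U}.
      (U \<inter> Z2_pow n) \<union> (+) t ` (U \<inter> Z2_pow n) = U"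
    by blast
  show "\<forall>W\<in>subspaces_in n (G \<inter> {u. u + t \<in> G}) d. (W \<union> (+) t ` W) \<inter> Z2_pow n = W"
    using t(2) by (fastforce simp: subspaces_in_def Z2_pow_def)
  show "(\<lambda>U. U \<inter> Z2_pow n) ` {U \<in> subspaces_in (Suc n) G (Suc d). t \<in> U}
      \<subseteq> subspaces_in n (G \<inter> {u. u + t \<in> G}) d"
  proof clarsimp
    fix U assume U: "U \<in> subspaces_in (Suc n) G (Suc d)" "t \<in> U"
    let ?W = "U \<inter> Z2_pow n"
    have W: "Z2v.subspace ?W"
      using U by (auto simp: subspaces_in_def intro!: Z2v.subspace_inter subspace_Z2_pow)
    have "2 ^ Suc d = 2 * card ?W"
      using card_Un_translate [OF W, of t] split [OF U] U t'
        card_subspace_of_Z2_pow [of U "Suc n"]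
      by (auto simp: subspaces_in_def)
    then have "Z2v.dim ?W = d"
      using card_subspace_of_Z2_pow [OF W, of n] by simp
    moreover have "u + t \<in> G" if "u \<in> ?W" for u
    proof -
      have "u + t \<in> U"
        using that U by (auto simp: subspaces_in_def Z2_subspace_iff)
      moreover have "u + t \<noteq> 0"
        using that t' by (auto simp: word_add_eq_0_iff)
      ultimately show ?thesis
        using U by (auto simp: subspaces_in_def)
    qed
    ultimately show "?W \<in> subspaces_in n (G \<inter> {u. u + t \<in> G}) d"
      using U W by (auto simp: subspaces_in_def)
  qed
  show "(\<lambda>W. W \<union> (+) t ` W) ` subspaces_in n (G \<inter> {u. u + t \<in> G}) d
      \<subseteq> {U \<in> subspaces_in (Suc n) G (Suc d). t \<in> U}"
  proof clarsimp
    fix W assume "W \<in> subspaces_in n (G \<inter> {u. u + t \<in> G}) d"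
    then have W: "Z2v.subspace W" "W \<subseteq> Z2_pow n" "W - {0} \<subseteq> G \<inter> {u. u + t \<in> G}"
      "Z2v.dim W = d"
      by (auto simp: subspaces_in_def)
    let ?U = "W \<union> (+) t ` W"
    have "W \<subseteq> Z2_pow (Suc n)"
      using W(2) by (auto simp: Z2_pow_def)
    then have U: "Z2v.subspace ?U" "?U \<subseteq> Z2_pow (Suc n)"
      using subspace_Un_translate [OF W(1)] t(1) by (auto intro: Z2_pow_add)
    have "card ?U = 2 * card W"
      using t' W(2) by (intro card_Un_translate W(1) finite_subset [OF W(2)]) auto
    then have "(2 :: nat) ^ Z2v.dim ?U = 2 ^ Suc d"
      using card_subspace_of_Z2_pow [OF W(1,2)] card_subspace_of_Z2_pow [OF U] W(4) by simp
    then have "Z2v.dim ?U = Suc d"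
      by (subst (asm) power_inject_exp) auto
    moreover have "?U - {0} \<subseteq> G"
      using W(3) t(3) by (auto simp: add.commute)
    ultimately have "?U \<in> subspaces_in (Suc n) G (Suc d)"
      using U by (auto simp: subspaces_in_def)
    moreover have "t \<in> (+) t ` W"
      using zero_subspace [OF W(1)] by (metis add.right_neutral image_eqI)
    ultimately show "?U \<in> subspaces_in (Suc n) G (Suc d) \<and> (t \<in> W \<or> t \<in> (+) t ` W)"
      by blast
  qed
qed

text \<open>Double counting of the pairs of a subspace and a vector in it with last coordinate 1.\<close>

lemma card_subspaces_in_Suc:
  "card (subspaces_in (Suc n) G (Suc d)) * 2 ^ d =
     card (subspaces_in n G (Suc d)) * 2 ^ d +
     (\<Sum>v | v \<in> Z2_pow (Suc n) \<and> v n = 1 \<and> v \<in> G.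
        card (subspaces_in n (G \<inter> {u. u + v \<in> G}) d))"
proof -
  let ?S = "subspaces_in (Suc n) G (Suc d)"
  let ?V = "{v. v \<in> Z2_pow (Suc n) \<and> v n = 1 \<and> v \<in> G}"
  define X where "X = {U \<in> ?S. \<not> U \<subseteq> Z2_pow n}"
  have V: "finite ?V"
    by (rule finite_subset [OF _ finite_Z2_pow [of "Suc n"]]) auto
  have "Z2_pow n \<subseteq> Z2_pow (Suc n)"
    by (auto simp: Z2_pow_def)
  then have "?S = subspaces_in n G (Suc d) \<union> X"
    by (auto simp: X_def subspaces_in_def)
  moreover have "subspaces_in n G (Suc d) \<inter> X = {}"
    by (auto simp: X_def subspaces_in_def)
  moreover have X: "finite X"
    by (simp add: X_def)
  ultimately have S: "card ?S = card (subspaces_in n G (Suc d)) + card X"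
    by (simp add: card_Un_disjoint)
  \<comment> \<open>A subspace not inside the hyperplane \<open>Z2_pow n\<close> has exactly half of
    its 2^(d+1) vectors off it, and these are nonzero, hence in \<open>G\<close>.\<close>
  have half: "card {v \<in> ?V. v \<in> U} = 2 ^ d" if "U \<in> X" for U
  proof -
    have U: "Z2v.subspace U" "U \<subseteq> Z2_pow (Suc n)" "U - {0} \<subseteq> G" "Z2v.dim U = Suc d"
      using that by (auto simp: X_def subspaces_in_def)
    have "U \<inter> Z2_pow n \<noteq> U"
      using that by (auto simp: X_def)
    then obtain t where "t \<in> U" "t n \<noteq> 0"
      unfolding Z2_pow_Suc_Int [OF U(2)] by blast
    then have t: "t \<in> U" "t n = 1"
      by simp_all
    have fin: "finite U"
      by (rule finite_subset [OF U(2) finite_Z2_pow])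
    have "card {u \<in> U. u n = 1} = card {u \<in> U. u n = 0}"
      unfolding subspace_eq_Un_translate [OF U(1) t]
      by (intro card_image) (auto simp: inj_on_def)
    moreover have "U = {u \<in> U. u n = 1} \<union> {u \<in> U. u n = 0}"
      by (auto simp: bit_not_one_iff)
    then have "card U = card {u \<in> U. u n = 1} + card {u \<in> U. u n = 0}"
      using fin by (subst card_Un_disjoint [symmetric]) auto
    ultimately have "card {u \<in> U. u n = 1} = 2 ^ d"
      using card_subspace_of_Z2_pow [OF U(1,2)] U(4) by simp
    moreover have "{v \<in> ?V. v \<in> U} = {u \<in> U. u n = 1}"
      using U(2,3) by auto
    ultimately show ?thesis
      by simp
  qed
  have "card X * 2 ^ d = (\<Sum>U\<in>X. \<Sum>v | v \<in> ?V \<and> v \<in> U. 1)"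
    using half by simp
  also have "\<dots> = (\<Sum>v\<in>?V. \<Sum>U | U \<in> X \<and> v \<in> U. 1)"
    by (rule sum.swap_restrict [OF X V])
  also have "\<dots> = (\<Sum>v\<in>?V. card (subspaces_in n (G \<inter> {u. u + v \<in> G}) d))"
  proof (rule sum.cong [OF refl])
    fix v assume v: "v \<in> ?V"
    then have "{U. U \<in> X \<and> v \<in> U} = {U \<in> ?S. v \<in> U}"
      by (auto simp: X_def Z2_pow_def)
    then show "(\<Sum>U | U \<in> X \<and> v \<in> U. 1) = card (subspaces_in n (G \<inter> {u. u + v \<in> G}) d)"
      using bij_betw_same_card [OF bij_betw_subspaces_through [of v n G d]] v by simp
  qed
  finally show ?thesis
    by (simp add: S add_mult_distrib)
qed

section \<open>Counting subspaces with tries\<close>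

text \<open>A trie of depth \<open>n\<close> represents a set of vectors of length \<open>n\<close>: the root branches on the last
  coordinate, and accordingly bit lists start with the last coordinate. The subset of vectors \<open>u\<close> of
  \<open>a\<close> with \<open>u + w\<close> in \<open>b\<close> is \<open>shift_inter w a b\<close>.\<close>

datatype trie = Empty | Leaf | Node trie trie

fun vec :: "bool list \<Rightarrow> (nat \<Rightarrow> bit)" where
  "vec [] = 0"
| "vec (x # w) = (vec w)(length w := of_bool x)"

text \<open>\<open>Empty\<close> is legal at every depth and stands for the empty set of vectors; a
  \<open>Leaf\<close> occurs only at the bottom.\<close>

fun full_depth :: "nat \<Rightarrow> trie \<Rightarrow> bool" where
  "full_depth n Empty \<longleftrightarrow> True"
| "full_depth 0 Leaf \<longleftrightarrow> True"
| "full_depth (Suc n) (Node a b) \<longleftrightarrow> full_depth n a \<and> full_depth n b"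
| "full_depth _ _ \<longleftrightarrow> False"

fun mem :: "nat \<Rightarrow> trie \<Rightarrow> (nat \<Rightarrow> bit) \<Rightarrow> bool" where
  "mem 0 Leaf u \<longleftrightarrow> True"
| "mem (Suc n) (Node a b) u \<longleftrightarrow> (if u n = 1 then mem n b u else mem n a u)"
| "mem _ _ _ \<longleftrightarrow> False"

text \<open>Collapsing two empty children keeps tries pruned, so that recursions over them stop
  early.\<close>

fun node :: "trie \<Rightarrow> trie \<Rightarrow> trie" where
  "node Empty Empty = Empty"
| "node a b = Node a b"

fun shift_inter :: "bool list \<Rightarrow> trie \<Rightarrow> trie \<Rightarrow> trie" where
  "shift_inter [] Leaf Leaf = Leaf"
| "shift_inter (x # w) (Node a a') (Node b b') =
     (if x then node (shift_inter w a b') (shift_inter w a' b)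
      else node (shift_inter w a b) (shift_inter w a' b'))"
| "shift_inter _ _ _ = Empty"

fun elems :: "trie \<Rightarrow> bool list list" where
  "elems Empty = []"
| "elems Leaf = [[]]"
| "elems (Node a b) = map ((#) False) (elems a) @ map ((#) True) (elems b)"

text \<open>The weight \<open>2 ^ (d choose 2)\<close> with which a \<open>d\<close>-dimensional subspace is counted is the number of
  its echelon bases; it keeps the recursion free of divisions.\<close>

fun flags :: "nat \<Rightarrow> trie \<Rightarrow> int" where
  "flags 0 t = 1"
| "flags (Suc d) (Node a b) =
     flags (Suc d) a + (\<Sum>w\<leftarrow>elems b. flags d (shift_inter w a b))"
| "flags (Suc d) _ = 0"

text \<open>\<open>parity_trie n False\<close> holds the words of even weight, from which unwanted
  words are then deleted.\<close>

fun parity_trie :: "nat \<Rightarrow> bool \<Rightarrow> trie" where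
  "parity_trie 0 x = (if x then Empty else Leaf)"
| "parity_trie (Suc n) x = Node (parity_trie n x) (parity_trie n (\<not> x))"

text \<open>The catch-all clause covers both removal of the empty word from \<open>Leaf\<close> and
  deletion from \<open>Empty\<close>.\<close>

fun delete :: "bool list \<Rightarrow> trie \<Rightarrow> trie" where
  "delete (x # w) (Node a b) =
     (if x then node a (delete w b) else node (delete w a) b)"
| "delete _ _ = Empty"

section \<open>Correctness of the trie operations\<close>

lemma vec_in_Z2_pow: "vec w \<in> Z2_pow (length w)"
  by (induction w) (auto simp: Z2_pow_def)

lemma vec_eq_0: "length w \<le> i \<Longrightarrow> vec w i = 0"
  using vec_in_Z2_pow [of w] by (simp add: Z2_pow_def)

lemma inj_on_vec: "inj_on vec {w. length w = n}"
proof (induction n)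
  case (Suc n)
  show ?case
  proof (rule inj_onI)
    fix v w assume vw: "v \<in> {w. length w = Suc n}" "w \<in> {w. length w = Suc n}" "vec v = vec w"
    then obtain x v' y w' where eq: "v = x # v'" "w = y # w'" "length v' = n" "length w' = n"
      by (auto simp: length_Suc_conv)
    have "x = y"
      using fun_cong [OF vw(3), of n] by (cases x; cases y) (simp_all add: eq)
    moreover have "vec v' i = vec w' i" for i
      using fun_cong [OF vw(3), of i] vec_eq_0 [of v'] vec_eq_0 [of w'] by (cases "i = n") (auto simp: eq)
    then have "v' = w'"
      using Suc eq by (auto simp: inj_on_def fun_eq_iff)
    ultimately show "v = w"
      by (simp add: eq)
  qed
qed (auto simp: inj_on_def)

lemma vec_surj: "v \<in> Z2_pow n \<Longrightarrow> \<exists>w. length w = n \<and> vec w = v"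
proof (induction n arbitrary: v)
  case (Suc n)
  have "v(n := 0) \<in> Z2_pow n"
    using Suc.prems by (auto simp: Z2_pow_def)
  then obtain w where "length w = n" "vec w = v(n := 0)"
    using Suc.IH by blast
  then have "length ((v n = 1) # w) = Suc n \<and> vec ((v n = 1) # w) = v"
    by (auto simp: fun_eq_iff)
  then show ?case
    by blast
qed auto

lemma vec_image_lists: "vec ` {w. length w = n} = Z2_pow n"
  using vec_surj vec_in_Z2_pow by (auto simp: image_iff)

lemma vec_map2_neq:
  "length v = length w \<Longrightarrow> vec (map2 (\<noteq>) v w) = vec v + vec w"
  by (induction v w rule: list_induct2) (auto simp: fun_eq_iff)

lemma mem_cong: "(\<And>i. i < n \<Longrightarrow> u i = v i) \<Longrightarrow> mem n t u = mem n t v"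
  by (induction n t u rule: mem.induct) auto

lemma mem_fun_upd [simp]: "mem n t (u(n := x)) = mem n t u"
  by (rule mem_cong) simp

lemma mem_Empty [simp]: "\<not> mem n Empty u"
  by (cases n) auto

lemma mem_node: "mem (Suc n) (node a b) u = mem (Suc n) (Node a b) u"
  by (cases a; cases b) simp_all

lemma full_depth_node: "full_depth n a \<Longrightarrow> full_depth n b \<Longrightarrow> full_depth (Suc n) (node a b)"
  by (cases a; cases b) simp_all

lemma full_depth_Suc_cases:
  assumes "full_depth (Suc n) t"
  obtains "t = Empty" | a b where "t = Node a b" "full_depth n a" "full_depth n b"
  using assms by (cases t) auto

lemma full_depth_0_cases:
  assumes "full_depth 0 t"
  obtains "t = Empty" | "t = Leaf"
  using assms by (cases t) auto

text \<open>A shift with leading bit \<open>x\<close> exchanges the two children of \<open>b\<close>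
  exactly when \<open>x\<close> holds; the remaining bits act within the children.\<close>

lemma shift_inter_spec:
  assumes "full_depth n a" "full_depth n b" "length w = n"
  shows "full_depth n (shift_inter w a b) \<and>
    (\<forall>u. mem n (shift_inter w a b) u \<longleftrightarrow> mem n a u \<and> mem n b (u + vec w))"
  using assms
proof (induction n arbitrary: a b w)
  case 0
  then show ?case
    by (auto elim!: full_depth_0_cases)
next
  case (Suc n)
  show ?case
  proof (cases "a = Empty \<or> b = Empty")
    case True
    then show ?thesis
      by auto
  next
    case False
    then obtain a0 a1 b0 b1 where ab: "a = Node a0 a1" "b = Node b0 b1"
      "full_depth n a0" "full_depth n a1" "full_depth n b0" "full_depth n b1"
      using Suc.prems by (metis full_depth_Suc_cases)
    obtain x w' where w: "w = x # w'" "length w' = n"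
      using Suc.prems(3) by (auto simp: length_Suc_conv)
    \<comment> \<open>Membership at depth \<open>n\<close> reads only coordinates below
      \<open>n\<close>, where \<open>vec w\<close> and \<open>vec w'\<close> agree.\<close>
    have low: "mem n t (u + vec w) = mem n t (u + vec w')" for t u
      by (rule mem_cong) (simp add: w)
    have "(u + vec w) n = 1 \<longleftrightarrow> (u n = 1) \<noteq> x" for u
      by (cases x; cases "u n") (simp_all add: w)
    then have b: "mem (Suc n) b (u + vec w) =
        (if (u n = 1) \<noteq> x then mem n b1 (u + vec w') else mem n b0 (u + vec w'))" for u
      unfolding ab mem.simps low by presburger
    have IH: "full_depth n (shift_inter w' c d)"
      "mem n (shift_inter w' c d) u \<longleftrightarrow> mem n c u \<and> mem n d (u + vec w')"
      if "full_depth n c" "full_depth n d" for c d u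
      using Suc.IH [OF that w(2)] by blast+
    have "full_depth (Suc n) (shift_inter w a b)"
      by (simp add: ab w(1) full_depth_node IH(1))
    moreover have "mem (Suc n) (shift_inter w a b) u \<longleftrightarrow>
        mem (Suc n) a u \<and> mem (Suc n) b (u + vec w)" for u
      unfolding b unfolding ab(1,2) w(1)
      by (cases x; cases "u n = 1")
        (simp_all only: shift_inter.simps if_True if_False mem_node mem.simps IH(2) [OF ab(3) ab(5)]
          IH(2) [OF ab(3) ab(6)] IH(2) [OF ab(4) ab(5)] IH(2) [OF ab(4) ab(6)] simp_thms)
    ultimately show ?thesis
      by blast
  qed
qed

lemma elems_spec:
  assumes "full_depth n t"
  shows "set (elems t) = {w. length w = n \<and> mem n t (vec w)} \<and> distinct (elems t)"
  using assms
proof (induction n arbitrary: t)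
  case 0
  then show ?case
    by (auto elim!: full_depth_0_cases)
next
  case (Suc n)
  from Suc.prems show ?case
  proof (cases rule: full_depth_Suc_cases)
    case (2 a b)
    have "set (elems t) = {w. length w = Suc n \<and> mem (Suc n) t (vec w)}"
    proof (intro set_eqI)
      fix w
      show "w \<in> set (elems t) \<longleftrightarrow> w \<in> {w. length w = Suc n \<and> mem (Suc n) t (vec w)}"
        using Suc.IH [OF 2(2)] Suc.IH [OF 2(3)]
        by (cases w) (auto simp: 2(1))
    qed
    moreover have "distinct (elems t)"
      using Suc.IH [OF 2(2)] Suc.IH [OF 2(3)] by (auto simp: 2(1) distinct_map)
    ultimately show ?thesis
      by blast
  qed auto
qed

lemma sum_elems:
  assumes "full_depth n t"
  shows "(\<Sum>w\<leftarrow>elems t. f (vec w)) = (\<Sum>v | v \<in> Z2_pow n \<and> mem n t v. f v)"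
proof -
  have "(\<Sum>w\<leftarrow>elems t. f (vec w)) = (\<Sum>w | length w = n \<and> mem n t (vec w). f (vec w))"
    using elems_spec [OF assms] by (simp add: sum_list_distinct_conv_sum_set)
  also have "\<dots> = (\<Sum>v\<in>vec ` {w. length w = n \<and> mem n t (vec w)}. f v)"
    by (subst sum.reindex) (auto intro: inj_on_subset [OF inj_on_vec])
  also have "vec ` {w. length w = n \<and> mem n t (vec w)} = {v. v \<in> Z2_pow n \<and> mem n t v}"
    by (auto simp flip: vec_image_lists)
  finally show ?thesis .
qed

text \<open>Outer induction on the dimension, inner on the length. The lower child accounts for the
  subspaces with all last coordinates 0, and each element of the upper child starts a count in
  dimension one less; the weights turn \<open>card_subspaces_in_Suc\<close> into the defining
  equation of \<open>flags\<close>.\<close>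

lemma flags_correct:
  assumes "full_depth n t"
  shows "int (card (subspaces_in n {u. mem n t u} d)) * 2 ^ (d choose 2) = flags d t"
  using assms
proof (induction d arbitrary: n t)
  case 0
  then show ?case
    by (simp add: subspaces_in_0 binomial_eq_0)
next
  case (Suc d)
  note IH_d = Suc.IH
  from Suc.prems show ?case
  proof (induction n arbitrary: t)
    case 0
    then show ?case
      by (auto elim!: full_depth_0_cases simp: subspaces_in_empty)
  next
    case (Suc n)
    from Suc.prems show ?case
    proof (cases rule: full_depth_Suc_cases)
      case 1
      then show ?thesis
        by (simp add: subspaces_in_empty)
    next
      case (2 a b)
      let ?G = "{u. mem (Suc n) t u}"
      let ?H = "\<lambda>v. {u. mem n a u \<and> mem n b (u + v)}"
      have low: "subspaces_in n ?G (Suc d) = subspaces_in n {u. mem n a u} (Suc d)"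
        by (rule subspaces_in_cong) (auto simp: 2(1) Z2_pow_def)
      \<comment> \<open>For \<open>u\<close> of length \<open>n\<close> the vector
        \<open>u + v(n := 1)\<close> has last coordinate 1, so its membership is decided in
        \<open>b\<close>, and that of \<open>u\<close> in \<open>a\<close>.\<close>
      have fibre: "subspaces_in n (?G \<inter> {u. u + v(n := 1) \<in> ?G}) d = subspaces_in n (?H v) d" for v
      proof (rule subspaces_in_cong)
        have low: "mem n b (u + v(n := 1)) = mem n b (u + v)" for u
          by (rule mem_cong) simp
        have "mem (Suc n) t (u + v(n := 1)) = mem n b (u + v)" "mem (Suc n) t u = mem n a u"
          if "u \<in> Z2_pow n" for u
        proof -
          have "u n = 0"
            using that by (simp add: Z2_pow_def)
          then show "mem (Suc n) t (u + v(n := 1)) = mem n b (u + v)" "mem (Suc n) t u = mem n a u"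
            unfolding 2(1) mem.simps low by simp_all
        qed
        then show "?G \<inter> {u. u + v(n := 1) \<in> ?G} \<inter> Z2_pow n = ?H v \<inter> Z2_pow n"
          by blast
      qed
      have "(\<Sum>v | v \<in> Z2_pow (Suc n) \<and> v n = 1 \<and> v \<in> ?G.
                int (card (subspaces_in n (?G \<inter> {u. u + v \<in> ?G}) d)))
          = (\<Sum>v | v \<in> Z2_pow n \<and> mem n b v. int (card (subspaces_in n (?H v) d)))"
      \<comment> \<open>Vectors with last coordinate 1 are matched with their first \<open>n\<close>
        coordinates.\<close>
      proof (rule sum.reindex_bij_witness [where i = "\<lambda>v. v(n := 1)" and j = "\<lambda>v. v(n := 0)"])
        fix v assume v: "v \<in> {v. v \<in> Z2_pow (Suc n) \<and> v n = 1 \<and> v \<in> ?G}"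
        then show "(v(n := 0))(n := 1) = v"
          by (auto simp: fun_eq_iff)
        then show "int (card (subspaces_in n (?H (v(n := 0))) d)) =
            int (card (subspaces_in n (?G \<inter> {u. u + v \<in> ?G}) d))"
          using fibre [of "v(n := 0)"] by simp
        have "mem n b (v(n := 0)) = mem n b v"
          by (rule mem_cong) simp
        then show "v(n := 0) \<in> {v. v \<in> Z2_pow n \<and> mem n b v}"
          using v by (auto simp: 2(1) Z2_pow_def)
      next
        fix v assume v: "v \<in> {v. v \<in> Z2_pow n \<and> mem n b v}"
        then show "(v(n := 1))(n := 0) = v"
          by (auto simp: fun_eq_iff Z2_pow_def)
        have "mem n b (v(n := 1)) = mem n b v"
          by (rule mem_cong) simp
        then show "v(n := 1) \<in> {v. v \<in> Z2_pow (Suc n) \<and> v n = 1 \<and> v \<in> ?G}"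
          using v by (auto simp: 2(1) Z2_pow_def)
      qed
      also have "\<dots> = (\<Sum>w\<leftarrow>elems b. int (card (subspaces_in n (?H (vec w)) d)))"
        using sum_elems [OF 2(3), of "\<lambda>v. int (card (subspaces_in n (?H v) d))"] by simp
      finally have
        "(\<Sum>v | v \<in> Z2_pow (Suc n) \<and> v n = 1 \<and> v \<in> ?G.
            int (card (subspaces_in n (?G \<inter> {u. u + v \<in> ?G}) d))) * 2 ^ (d choose 2)
          = (\<Sum>w\<leftarrow>elems b. int (card (subspaces_in n (?H (vec w)) d)) * 2 ^ (d choose 2))"
        by (simp add: sum_list_mult_const)
      also have "\<dots> = (\<Sum>w\<leftarrow>elems b. flags d (shift_inter w a b))"
      proof (rule arg_cong [of _ _ sum_list], rule map_cong [OF refl])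
        fix w assume "w \<in> set (elems b)"
        then have "length w = n"
          using elems_spec [OF 2(3)] by auto
        then show "int (card (subspaces_in n (?H (vec w)) d)) * 2 ^ (d choose 2) =
            flags d (shift_inter w a b)"
          using IH_d [of n "shift_inter w a b"] shift_inter_spec [OF 2(2,3), of w] by simp
      qed
      finally have upper: "(\<Sum>v | v \<in> Z2_pow (Suc n) \<and> v n = 1 \<and> v \<in> ?G.
          int (card (subspaces_in n (?G \<inter> {u. u + v \<in> ?G}) d))) * 2 ^ (d choose 2)
          = (\<Sum>w\<leftarrow>elems b. flags d (shift_inter w a b))" .
      \<comment> \<open>By this identity the factor \<open>2 ^ d\<close> of the double count and the
        weight \<open>2 ^ (d choose 2)\<close> multiply to the weight of dimension
        \<open>Suc d\<close>.\<close>
      have choose: "Suc d choose 2 = d + (d choose 2)"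
        by (simp add: numeral_2_eq_2)
      have "int (card (subspaces_in (Suc n) ?G (Suc d))) * 2 ^ d =
          int (card (subspaces_in n ?G (Suc d))) * 2 ^ d +
          (\<Sum>v | v \<in> Z2_pow (Suc n) \<and> v n = 1 \<and> v \<in> ?G.
            int (card (subspaces_in n (?G \<inter> {u. u + v \<in> ?G}) d)))"
        using arg_cong [OF card_subspaces_in_Suc [of n ?G d], of int]
        unfolding of_nat_add of_nat_mult of_nat_sum of_nat_power of_nat_numeral .
      then have "int (card (subspaces_in (Suc n) ?G (Suc d))) * 2 ^ (Suc d choose 2) =
          int (card (subspaces_in n ?G (Suc d))) * 2 ^ (Suc d choose 2) +
          (\<Sum>v | v \<in> Z2_pow (Suc n) \<and> v n = 1 \<and> v \<in> ?G.
            int (card (subspaces_in n (?G \<inter> {u. u + v \<in> ?G}) d))) * 2 ^ (d choose 2)"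
        unfolding choose power_add by (metis (no_types, lifting) distrib_right mult.assoc)
      then show ?thesis
        unfolding upper low by (simp add: Suc.IH [OF 2(2)] 2(1))
    qed
  qed
qed

section \<open>Tries of words of given parity, and deletion of words\<close>

lemma mem_parity_trie: "mem n (parity_trie n x) u \<longleftrightarrow> (\<Sum>i<n. u i) = of_bool x"
proof (induction n arbitrary: x)
  case (Suc n)
  show ?case
    by (cases "u n"; cases x) (simp_all add: Suc)
qed (cases x; simp)

lemma full_depth_parity_trie: "full_depth n (parity_trie n x)"
  by (induction n arbitrary: x) auto

lemma delete_spec:
  assumes "full_depth n t" "length w = n"
  shows "full_depth n (delete w t) \<and>
    (\<forall>u\<in>Z2_pow n. mem n (delete w t) u \<longleftrightarrow> mem n t u \<and> u \<noteq> vec w)"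
  using assms
proof (induction n arbitrary: t w)
  case 0
  then show ?case
    by (auto elim!: full_depth_0_cases)
next
  case (Suc n)
  from Suc.prems(1) show ?case
  proof (cases rule: full_depth_Suc_cases)
    case (2 a b)
    obtain x w' where w: "w = x # w'" "length w' = n"
      using Suc.prems(2) by (auto simp: length_Suc_conv)
    have "mem (Suc n) (delete w t) u \<longleftrightarrow> mem (Suc n) t u \<and> u \<noteq> vec w"
      if u: "u \<in> Z2_pow (Suc n)" for u
    proof -
      let ?u = "u(n := 0)"
      have u': "?u \<in> Z2_pow n"
        using u by (auto simp: Z2_pow_def)
      have low: "mem n c ?u = mem n c u" for c
        by (rule mem_cong) simp
      have "u = vec w \<longleftrightarrow> u n = of_bool x \<and> ?u = vec w'"
        using vec_eq_0 [of w' n] w by (auto simp: fun_eq_iff)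
      moreover have "u n = of_bool x \<longleftrightarrow> (u n = 1 \<longleftrightarrow> x)"
        by (cases x) auto
      moreover have "mem n (delete w' c) u \<longleftrightarrow> mem n c u \<and> ?u \<noteq> vec w'" if "full_depth n c" for c
        using Suc.IH [OF that w(2)] u' low by blast
      ultimately show ?thesis
        using 2(2,3) by (cases x) (auto simp: 2(1) w(1) mem_node)
    qed
    then show ?thesis
      using 2 Suc.IH w(2) by (auto simp: w(1) full_depth_node)
  qed auto
qed

lemma fold_delete_spec:
  assumes "full_depth n t" "\<forall>w\<in>set ws. length w = n"
  shows "full_depth n (fold delete ws t) \<and>
    (\<forall>u\<in>Z2_pow n. mem n (fold delete ws t) u \<longleftrightarrow> mem n t u \<and> u \<notin> vec ` set ws)"
  using assms
proof (induction ws arbitrary: t)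
  case (Cons w ws)
  then show ?case
    using delete_spec [of n t w] by auto
qed auto

section \<open>Weights\<close>

lemma even_of_nat_bit: "even n \<longleftrightarrow> (of_nat n :: bit) = 0"
  by (induction n) auto

lemma weight_support:
  assumes "x \<in> Z2_pow n"
  shows "{i. x i = 1} = {i\<in>{..<n}. x i = 1}"
  using assms by (auto simp: Z2_pow_def) (metis not_le zero_neq_one)

lemma finite_support: "x \<in> Z2_pow n \<Longrightarrow> finite {i. x i = 1}"
  by (simp add: weight_support)

text \<open>Parity of the weight becomes a linear functional, so evenness is a subspace
  condition.\<close>

lemma even_weight_iff:
  assumes "x \<in> Z2_pow n"
  shows "even (weight x) \<longleftrightarrow> (\<Sum>i<n. x i) = 0"
proof -
  have "(of_nat (weight x) :: bit) = (\<Sum>i | i \<in> {..<n} \<and> x i = 1. 1)"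
    by (simp add: weight_def weight_support [OF assms])
  also have "\<dots> = (\<Sum>i<n. if x i = 1 then 1 else 0)"
    by (simp add: sum.If_cases Int_def)
  also have "\<dots> = (\<Sum>i<n. x i)"
    by (rule sum.cong) auto
  finally show ?thesis
    by (simp add: even_of_nat_bit)
qed

lemma weight_0 [simp]: "weight 0 = 0"
  by (simp add: weight_def)

lemma weight_eq_0_iff:
  assumes "x \<in> Z2_pow n"
  shows "weight x = 0 \<longleftrightarrow> x = 0"
  using finite_support [OF assms] by (auto simp: weight_def fun_eq_iff)

text \<open>An even weight below 4 is 0 or 2, and weight 0 occurs only for the zero word. No
  exception for the zero word remains in this form.\<close>

lemma quad_code_iff:
  "quad_code l C \<longleftrightarrow> C \<subseteq> Z2_pow l \<and> Z2v.subspace C \<and> (\<forall>c\<in>C. even (weight c) \<and> weight c \<noteq> 2)"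
proof -
  have "4 \<le> weight c \<longleftrightarrow> weight c \<noteq> 2" if "c \<in> Z2_pow l" "even (weight c)" "c \<noteq> 0" for c
  proof -
    have "weight c \<noteq> 0"
      using that weight_eq_0_iff by blast
    with \<open>even (weight c)\<close> show ?thesis
      by (auto elim!: evenE)
  qed
  moreover have "weight 0 \<noteq> 2"
    by simp
  ultimately show ?thesis
    unfolding quad_code_def by (metis subsetD)
qed

definition unit :: "nat \<Rightarrow> (nat \<Rightarrow> bit)" where
  "unit p = (\<lambda>i. of_bool (i = p))"

lemma unit_in_Z2_pow: "p < n \<Longrightarrow> unit p \<in> Z2_pow n"
  by (auto simp: unit_def Z2_pow_def)

lemma weight_eq_2_iff:
  assumes "x \<in> Z2_pow n"
  shows "weight x = 2 \<longleftrightarrow> (\<exists>q<n. \<exists>p<q. x = unit p + unit q)"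
proof
  assume "weight x = 2"
  then obtain p q where "{i. x i = 1} = {p, q}" "p \<noteq> q"
    by (auto simp: weight_def card_2_iff)
  then obtain a b where ab: "{i. x i = 1} = {a, b}" "a < b"
    by (metis insert_commute linorder_neqE_nat)
  have supp: "x i = 1 \<longleftrightarrow> i = a \<or> i = b" for i
    using ab(1) by blast
  then have "b \<in> {i \<in> {..<n}. x i = 1}"
    unfolding weight_support [OF assms, symmetric] by blast
  then have "b < n"
    by simp
  moreover have "x i = (unit a + unit b) i" for i
    using supp [of i] ab(2) by (cases "x i") (auto simp: unit_def)
  then have "x = unit a + unit b"
    by blast
  ultimately show "\<exists>q<n. \<exists>p<q. x = unit p + unit q"
    using ab(2) by blast
next
  assume "\<exists>q<n. \<exists>p<q. x = unit p + unit q"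
  then obtain p q where "x = unit p + unit q" "p < q"
    by blast
  then have "{i. x i = 1} = {p, q}"
    by (auto simp: unit_def)
  with \<open>p < q\<close> show "weight x = 2"
    by (simp add: weight_def)
qed

section \<open>Codes above the semimagic code\<close>

text \<open>Index \<open>i\<close> stands for row \<open>i div 3\<close> and column
  \<open>i mod 3 + 1\<close>. Row r and column c of the square form position 4r + c, so 12 is the
  bottom left corner and \<open>13 + i mod 3\<close> lies in the bottom row.\<close>

definition reduce :: "(nat \<Rightarrow> bit) \<Rightarrow> (nat \<Rightarrow> bit)" where
  "reduce x = (\<lambda>i. if i < 9
     then x (4 * (i div 3) + i mod 3 + 1) + x (4 * (i div 3)) + x (13 + i mod 3) + x 12 else 0)"

lemma reduce_add: "reduce (x + y) = reduce x + reduce y"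
  by (auto simp: reduce_def fun_eq_iff ac_simps simp del: add_bit_eq_xor)

lemma reduce_0 [simp]: "reduce 0 = 0"
  by (simp add: reduce_def fun_eq_iff)

lemma reduce_in_Z2_pow: "reduce x \<in> Z2_pow 9"
  by (simp add: reduce_def Z2_pow_def)

text \<open>A section of \<open>reduce\<close>: the 3 x 3 matrix fills the top three rows and last
  three columns, with zeros in the first column and the bottom row.\<close>

definition lift :: "(nat \<Rightarrow> bit) \<Rightarrow> (nat \<Rightarrow> bit)" where
  "lift v = (\<lambda>i. if i < 12 \<and> i mod 4 \<noteq> 0 then v (3 * (i div 4) + i mod 4 - 1) else 0)"

lemma lift_in_Z2_pow: "lift v \<in> Z2_pow 16"
  by (simp add: lift_def Z2_pow_def)

lemma less_9_cases: "(\<forall>i<9::nat. P i) \<longleftrightarrow> P 0 \<and> P 1 \<and> P 2 \<and> P 3 \<and> P 4 \<and> P 5 \<and> P 6 \<and> P 7 \<and> P 8"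
  by (auto simp: numeral_eq_Suc All_less_Suc)

lemma less_16_cases: "(\<forall>i<16::nat. P i) \<longleftrightarrow> P 0 \<and> P 1 \<and> P 2 \<and> P 3 \<and> P 4 \<and> P 5 \<and> P 6 \<and> P 7 \<and>
    P 8 \<and> P 9 \<and> P 10 \<and> P 11 \<and> P 12 \<and> P 13 \<and> P 14 \<and> P 15"
  by (auto simp: numeral_eq_Suc All_less_Suc)

lemma word_eq_iff:
  assumes "u \<in> Z2_pow n" "v \<in> Z2_pow n"
  shows "u = v \<longleftrightarrow> (\<forall>i<n. u i = v i)"
  using assms by (auto simp: Z2_pow_def fun_eq_iff) (metis not_le)

lemma reduce_lift:
  assumes "v \<in> Z2_pow 9"
  shows "reduce (lift v) = v"
  unfolding word_eq_iff [OF reduce_in_Z2_pow assms] less_9_cases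
  by (simp add: reduce_def lift_def)

lemma bit_add_self: "(x :: bit) + x = 0"
  by simp

lemma bit_add_left_self: "(x :: bit) + (x + y) = y"
  by (cases x; cases y) simp_all

lemma bit_eq_add_iff: "(x :: bit) + y = 0 \<longleftrightarrow> x = y"
  by (cases x; cases y) simp_all

lemma sum_less_9: "sum f {..<9::nat} = f 0 + f 1 + f 2 + f 3 + f 4 + f 5 + f 6 + f 7 + f 8"
  by (simp add: numeral_eq_Suc)

lemma sum_less_16: "sum f {..<16::nat} = f 0 + f 1 + f 2 + f 3 + f 4 + f 5 + f 6 + f 7 + f 8 +
    f 9 + f 10 + f 11 + f 12 + f 13 + f 14 + f 15"
  by (simp add: numeral_eq_Suc)

text \<open>Summed over the 3 x 3 matrix, the bottom left corner occurs nine times, the other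
  entries of the first column and bottom row three times each, and all remaining entries once; every
  multiplicity is odd.\<close>

lemma sum_reduce: "(\<Sum>i<9. reduce x i) = (\<Sum>i<16. x i)"
  unfolding sum_less_9 sum_less_16
  by (simp add: reduce_def del: add_bit_eq_xor)
     (simp only: ac_simps bit_add_self bit_add_left_self add_0_left add_0_right
        numeral_2_eq_2 numeral_3_eq_3)

lemma word_in_Z2_pow: "length bs \<le> n \<Longrightarrow> word bs \<in> Z2_pow n"
  by (auto simp: word_def Z2_pow_def)

lemma subspace_reduce_vimage:
  assumes "Z2v.subspace U"
  shows "Z2v.subspace {x \<in> Z2_pow n. reduce x \<in> U}"
  using assms by (auto simp: Z2_subspace_iff reduce_add intro: Z2_pow_add)

lemma scale_in_Z2_pow: "x \<in> Z2_pow n \<Longrightarrow> scale_Z2 a x \<in> Z2_pow n"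
  by (simp add: Z2_pow_def scale_Z2_def)

text \<open>Each entry of \<open>reduce x\<close> sums \<open>x\<close> over the corners of a
  rectangle, and every row or column meets these corners in 0 or 2 positions. Conversely, a word
  with zero reduction is determined by its first column and bottom row.\<close>

lemma C_s_eq: "C_s = {x \<in> Z2_pow 16. reduce x = 0}"
proof
  have "row_words \<union> column_words \<subseteq> {x \<in> Z2_pow 16. reduce x \<in> {0}}"
    unfolding row_words_def column_words_def
    by (auto intro!: word_in_Z2_pow simp: word_eq_iff [OF reduce_in_Z2_pow zero_in_Z2_pow] less_9_cases)
      (simp_all add: reduce_def word_def)
  then show "C_s \<subseteq> {x \<in> Z2_pow 16. reduce x = 0}"
    unfolding C_s_def using Z2v.span_minimal [OF _ subspace_reduce_vimage [of "{0}" 16]] by auto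
next
  show "{x \<in> Z2_pow 16. reduce x = 0} \<subseteq> C_s"
  proof clarify
    fix x assume x: "x \<in> Z2_pow 16" "reduce x = 0"
    \<comment> \<open>With the four rows and the last three columns as generators, the first column
      of \<open>x\<close> forces the row coefficients and the bottom row then forces those of the
      columns.\<close>
    let ?y = "scale_Z2 (x 0) (word [1,1,1,1, 0,0,0,0, 0,0,0,0, 0,0,0,0]) +
      scale_Z2 (x 4) (word [0,0,0,0, 1,1,1,1, 0,0,0,0, 0,0,0,0]) +
      scale_Z2 (x 8) (word [0,0,0,0, 0,0,0,0, 1,1,1,1, 0,0,0,0]) +
      scale_Z2 (x 12) (word [0,0,0,0, 0,0,0,0, 0,0,0,0, 1,1,1,1]) +
      scale_Z2 (x 13 + x 12) (word [0,1,0,0, 0,1,0,0, 0,1,0,0, 0,1,0,0]) +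
      scale_Z2 (x 14 + x 12) (word [0,0,1,0, 0,0,1,0, 0,0,1,0, 0,0,1,0]) +
      scale_Z2 (x 15 + x 12) (word [0,0,0,1, 0,0,0,1, 0,0,0,1, 0,0,0,1])"
    have y: "?y \<in> C_s"
      unfolding C_s_def
      by (intro Z2v.span_add Z2v.span_scale Z2v.span_base)
        (auto simp: row_words_def column_words_def)
    \<comment> \<open>Vanishing of \<open>reduce x\<close> expresses the nine remaining entries
      through the first column and the bottom row.\<close>
    have "x (4 * (i div 3) + i mod 3 + 1) = x (4 * (i div 3)) + x (13 + i mod 3) + x 12"
      if "i < 9" for i
    proof -
      have "x (4 * (i div 3) + i mod 3 + 1) + (x (4 * (i div 3)) + x (13 + i mod 3) + x 12) = 0"
        using fun_cong [OF x(2), of i] that unfolding reduce_def by (simp only: if_True add.assoc zero_fun_apply)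
      then show ?thesis
        unfolding bit_eq_add_iff .
    qed
    note eq = this
    have eq1: "x 1 = x 0 + x 13 + x 12"
      using eq [of 0] by (simp del: add_bit_eq_xor flip: numeral_2_eq_2 numeral_3_eq_3)
    have eq2: "x 2 = x 0 + x 14 + x 12"
      using eq [of 1] by (simp del: add_bit_eq_xor flip: numeral_2_eq_2 numeral_3_eq_3)
    have eq3: "x 3 = x 0 + x 15 + x 12"
      using eq [of 2] by (simp del: add_bit_eq_xor flip: numeral_2_eq_2 numeral_3_eq_3)
    have eq5: "x 5 = x 4 + x 13 + x 12"
      using eq [of 3] by (simp del: add_bit_eq_xor flip: numeral_2_eq_2 numeral_3_eq_3)
    have eq6: "x 6 = x 4 + x 14 + x 12"
      using eq [of 4] by (simp del: add_bit_eq_xor flip: numeral_2_eq_2 numeral_3_eq_3)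
    have eq7: "x 7 = x 4 + x 15 + x 12"
      using eq [of 5] by (simp del: add_bit_eq_xor flip: numeral_2_eq_2 numeral_3_eq_3)
    have eq9: "x 9 = x 8 + x 13 + x 12"
      using eq [of 6] by (simp del: add_bit_eq_xor flip: numeral_2_eq_2 numeral_3_eq_3)
    have eq10: "x 10 = x 8 + x 14 + x 12"
      using eq [of 7] by (simp del: add_bit_eq_xor flip: numeral_2_eq_2 numeral_3_eq_3)
    have eq11: "x 11 = x 8 + x 15 + x 12"
      using eq [of 8] by (simp del: add_bit_eq_xor flip: numeral_2_eq_2 numeral_3_eq_3)
    note eqs = eq1 eq2 eq3 eq5 eq6 eq7 eq9 eq10 eq11
    have y': "?y \<in> Z2_pow 16"
      by (intro Z2_pow_add scale_in_Z2_pow word_in_Z2_pow) simp_all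
    have "x = ?y"
      unfolding word_eq_iff [OF x(1) y'] less_16_cases eqs
      by (simp add: word_def scale_Z2_def del: add_bit_eq_xor mult_bit_eq_and)
    with y show "x \<in> C_s"
      by simp
  qed
qed

text \<open>All fibres over the image are translates of the kernel. The codomain is a general group
  so that a parity and a vector sum can be paired in one map.\<close>

lemma card_additive_image:
  fixes f :: "(nat \<Rightarrow> bit) \<Rightarrow> 'a :: ab_group_add"
  assumes S: "Z2v.subspace S" "finite S"
    and f: "\<And>x y. x \<in> S \<Longrightarrow> y \<in> S \<Longrightarrow> f (x + y) = f x + f y"
  shows "card S = card (f ` S) * card {x \<in> S. f x = 0}"
proof -
  have add: "x + y \<in> S" if "x \<in> S" "y \<in> S" for x y
    using S(1) that by (simp add: Z2_subspace_iff)
  have "card {x \<in> S. f x = b} = card {x \<in> S. f x = 0}" if "b \<in> f ` S" for b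
  proof -
    obtain x where x: "x \<in> S" "b = f x"
      using \<open>b \<in> f ` S\<close> by blast
    \<comment> \<open>Values of \<open>f\<close> on \<open>S\<close> have order at most 2, so
      translation by \<open>x\<close> takes the kernel to the fibre over \<open>f x\<close> and
      back.\<close>
    have "f x + f x = f (x + x)"
      by (rule f [OF x(1) x(1), symmetric])
    also have "\<dots> = 0"
      using f [OF zero_subspace zero_subspace] S(1) by simp
    finally have neg: "f x + f x = 0" .
    have "bij_betw ((+) x) {x \<in> S. f x = 0} {y \<in> S. f y = b}"
      by (rule bij_betw_byWitness [where f' = "(+) x"]) (auto simp: f add x neg)
    then show ?thesis
      by (rule bij_betw_same_card [symmetric])
  qed
  then have "card S = (\<Sum>b\<in>f ` S. card {x \<in> S. f x = 0})"
    using sum.image_gen [OF S(2), of "\<lambda>_. 1 :: nat" f] by simp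
  then show ?thesis
    by simp
qed

section \<open>The correspondence between subspaces of Z_2^9 and codes above
  \<open>C_s\<close>\<close>

definition expand :: "(nat \<Rightarrow> bit) set \<Rightarrow> (nat \<Rightarrow> bit) set" where
  "expand U = {x \<in> Z2_pow 16. reduce x \<in> U}"

lemma subspace_expand: "Z2v.subspace U \<Longrightarrow> Z2v.subspace (expand U)"
  unfolding expand_def by (rule subspace_reduce_vimage)

lemma reduce_image_expand:
  assumes "U \<subseteq> Z2_pow 9"
  shows "reduce ` expand U = U"
proof
  show "U \<subseteq> reduce ` expand U"
  proof
    fix u assume "u \<in> U"
    then have "reduce (lift u) = u" "lift u \<in> expand U"
      using assms by (auto simp: expand_def lift_in_Z2_pow reduce_lift)
    then show "u \<in> reduce ` expand U"
      by (metis image_eqI)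
  qed
qed (auto simp: expand_def)

text \<open>Words with equal reduction differ by an element of \<open>C_s\<close>, which
  \<open>C\<close> contains.\<close>

lemma expand_reduce_image:
  assumes "Z2v.subspace C" "C_s \<subseteq> C" "C \<subseteq> Z2_pow 16"
  shows "expand (reduce ` C) = C"
proof (intro equalityI subsetI)
  fix x assume "x \<in> expand (reduce ` C)"
  then obtain y where y: "x \<in> Z2_pow 16" "y \<in> C" "reduce x = reduce y"
    by (auto simp: expand_def)
  then have "x + y \<in> C_s"
    using assms(3) by (auto simp: C_s_eq reduce_add intro: Z2_pow_add)
  then have "y + (x + y) \<in> C"
    using assms(1,2) y(2) unfolding Z2_subspace_iff by blast
  moreover have "y + (x + y) = x"
    by (metis add.commute word_add_left_self)
  ultimately show "x \<in> C"
    by simp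
qed (use assms in \<open>auto simp: expand_def\<close>)

lemma subspace_reduce_image: "Z2v.subspace C \<Longrightarrow> Z2v.subspace (reduce ` C)"
proof -
  assume C: "Z2v.subspace C"
  then have "0 \<in> reduce ` C"
    by (metis image_eqI reduce_0 zero_subspace)
  with C show ?thesis
    unfolding Z2_subspace_iff by (auto simp flip: reduce_add)
qed

lemma card_expand:
  assumes "Z2v.subspace U" "U \<subseteq> Z2_pow 9"
  shows "card (expand U) = card U * card C_s"
proof -
  have "finite (expand U)"
    by (rule finite_subset [of _ "Z2_pow 16"]) (auto simp: expand_def)
  moreover have "{x \<in> expand U. reduce x = 0} = C_s"
    using zero_subspace [OF assms(1)] by (auto simp: expand_def C_s_eq)
  ultimately show ?thesis
    using card_additive_image [OF subspace_expand [OF assms(1)], of reduce]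
    by (simp add: reduce_add reduce_image_expand assms)
qed

lemma dim_expand:
  assumes "Z2v.subspace U" "U \<subseteq> Z2_pow 9"
  shows "Z2v.dim (expand U) = Z2v.dim U + 7"
proof -
  \<comment> \<open>For all of Z_2^9 the size formula shows that \<open>C_s\<close> has 2^16 / 2^9 =
    2^7 elements, whence the 7.\<close>
  have "expand (Z2_pow 9) = Z2_pow 16"
    by (auto simp: expand_def reduce_in_Z2_pow)
  then have "card C_s = 2 ^ 7"
    using card_expand [OF subspace_Z2_pow order_refl] by (simp add: card_Z2_pow)
  moreover have "expand U \<subseteq> Z2_pow 16"
    by (auto simp: expand_def)
  ultimately have "(2 :: nat) ^ Z2v.dim (expand U) = 2 ^ (Z2v.dim U + 7)"
    using card_expand [OF assms] card_subspace_of_Z2_pow [OF assms]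
      card_subspace_of_Z2_pow [OF subspace_expand [OF assms(1)]]
    by (simp add: power_add)
  then show ?thesis
    by (subst (asm) power_inject_exp) auto
qed

section \<open>The admissible words of Z_2^9 as a trie\<close>

definition bits :: "nat \<Rightarrow> (nat \<Rightarrow> bit) \<Rightarrow> bool list" where
  "bits n v = map (\<lambda>i. v i = 1) (rev [0..<n])"

lemma length_bits [simp]: "length (bits n v) = n"
  by (simp add: bits_def)

lemma vec_bits:
  assumes "v \<in> Z2_pow n"
  shows "vec (bits n v) = v"
proof -
  have "vec (bits m v) i = (if i < m then v i else 0)" for m i
    by (induction m) (auto simp: bits_def less_Suc_eq)
  then show ?thesis
    using assms by (auto simp: fun_eq_iff Z2_pow_def)
qed

definition reduced_units :: "bool list list" where
  "reduced_units = map (\<lambda>p. bits 9 (reduce (unit p))) [0..<16]"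

text \<open>A literal table as code equation, so that evaluation does not have to compute with words
  represented as functions.\<close>

lemma reduced_units_code [code]:
  "reduced_units =
    [[False, False, False, False, False, False, True, True, True],
     [False, False, False, False, False, False, False, False, True],
     [False, False, False, False, False, False, False, True, False],
     [False, False, False, False, False, False, True, False, False],
     [False, False, False, True, True, True, False, False, False],
     [False, False, False, False, False, True, False, False, False],
     [False, False, False, False, True, False, False, False, False],
     [False, False, False, True, False, False, False, False, False],
     [True, True, True, False, False, False, False, False, False],
     [False, False, True, False, False, False, False, False, False],
     [False, True, False, False, False, False, False, False, False],
     [True, False, False, False, False, False, False, False, False],
     [True, True, True, True, True, True, True, True, True],
     [False, False, True, False, False, True, False, False, True],
     [False, True, False, False, True, False, False, True, False],
     [True, False, False, True, False, False, True, False, False]]"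
proof -
  have upt: "[0..<9] = [0, 1, 2, 3, 4, 5, 6, 7, 8]"
    "[0..<16] = [0, 1, 2, 3, 4, 5, 6, 7, 8, 9, 10, 11, 12, 13, 14, 15]"
    by (simp_all add: upt_rec)
  show ?thesis
    unfolding reduced_units_def bits_def upt by (simp add: reduce_def unit_def)
qed

text \<open>By additivity of \<open>reduce\<close>, this exclusive or of two reduced unit words is
  the reduction of a word of weight 2 when \<open>p \<noteq> q\<close>.\<close>

definition bad_word :: "nat \<Rightarrow> nat \<Rightarrow> bool list" where
  "bad_word p q = map2 (\<noteq>) (reduced_units ! p) (reduced_units ! q)"

definition bad_words :: "bool list list" where
  "bad_words = [bad_word p q. q \<leftarrow> [0..<16], p \<leftarrow> [0..<q]]"

definition quad_trie :: trie where
  "quad_trie = fold delete bad_words (parity_trie 9 False)"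

lemma set_bad_words: "set bad_words = {bad_word p q | p q. p < q \<and> q < 16}"
  unfolding bad_words_def by force

lemma bad_word:
  assumes "p < q" "q < 16"
  shows "vec (bad_word p q) = reduce (unit p + unit q)" "length (bad_word p q) = 9"
proof -
  have units: "reduced_units ! p = bits 9 (reduce (unit p))" "reduced_units ! q = bits 9 (reduce (unit q))"
    using assms by (simp_all add: reduced_units_def)
  then show "vec (bad_word p q) = reduce (unit p + unit q)"
    using vec_map2_neq [of "reduced_units ! p" "reduced_units ! q"]
    by (simp only: bad_word_def length_bits vec_bits reduce_in_Z2_pow reduce_add simp_thms)
  show "length (bad_word p q) = 9"
    by (simp add: bad_word_def units)
qed

lemma vec_bad_words: "vec ` set bad_words = {reduce (unit p + unit q) | p q. p < q \<and> q < 16}"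
proof -
  have "vec ` set bad_words = {vec (bad_word p q) | p q. p < q \<and> q < 16}"
    unfolding set_bad_words by blast
  also have "\<dots> = {reduce (unit p + unit q) | p q. p < q \<and> q < 16}"
    using bad_word(1) by metis
  finally show ?thesis .
qed

lemma length_bad_words: "w \<in> set bad_words \<Longrightarrow> length w = 9"
  unfolding set_bad_words using bad_word(2) by blast

lemma full_depth_quad_trie: "full_depth 9 quad_trie"
  unfolding quad_trie_def
  using fold_delete_spec [OF full_depth_parity_trie] length_bad_words by blast

text \<open>A word and its reduction have the same parity, so parity is constant on the fibres of
  \<open>reduce\<close>; and the fibre over \<open>v\<close> contains a word of weight 2 exactly
  when \<open>v\<close> is among the deleted words.\<close>

lemma mem_quad_trie:
  assumes "v \<in> Z2_pow 9"
  shows "mem 9 quad_trie v \<longleftrightarrow>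
    (\<forall>x\<in>Z2_pow 16. reduce x = v \<longrightarrow> even (weight x) \<and> weight x \<noteq> 2)"
proof -
  have "mem 9 quad_trie v \<longleftrightarrow> (\<Sum>i<9. v i) = 0 \<and> v \<notin> vec ` set bad_words"
    unfolding quad_trie_def
    using fold_delete_spec [OF full_depth_parity_trie, of bad_words 9 False] length_bad_words assms
    by (simp add: mem_parity_trie)
  moreover have "(\<Sum>i<9. v i) = 0 \<longleftrightarrow> (\<forall>x\<in>Z2_pow 16. reduce x = v \<longrightarrow> even (weight x))"
    using sum_reduce even_weight_iff [of _ 16] lift_in_Z2_pow reduce_lift [OF assms] by metis
  moreover have "v \<in> vec ` set bad_words \<longleftrightarrow> (\<exists>x\<in>Z2_pow 16. reduce x = v \<and> weight x = 2)"
  proof -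
    have "unit p + unit q \<in> Z2_pow 16" if "p < q" "q < 16" for p q
      using that by (intro Z2_pow_add unit_in_Z2_pow) auto
    then show ?thesis
      unfolding vec_bad_words using weight_eq_2_iff [of _ 16] by blast
  qed
  ultimately show ?thesis
    by blast
qed

text \<open>This amounts to \<open>C_s\<close> having no word of odd weight or of weight 2. It is
  evaluated on the list \<open>elems\<close>, since \<open>mem\<close> takes a function as
  argument.\<close>

lemma zero_in_quad_trie: "mem 9 quad_trie 0"
proof -
  have "replicate 9 False \<in> set (elems quad_trie)"
    by code_simp
  moreover have "vec (replicate n False) = 0" for n
    by (induction n) (auto simp: fun_eq_iff)
  ultimately show ?thesis
    using elems_spec [OF full_depth_quad_trie] by auto
qed

lemma quad_code_expand_iff:
  assumes "Z2v.subspace U" "U \<subseteq> Z2_pow 9"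
  shows "quad_code 16 (expand U) \<longleftrightarrow> U - {0} \<subseteq> {v. mem 9 quad_trie v}"
proof -
  have "quad_code 16 (expand U) \<longleftrightarrow> (\<forall>x\<in>expand U. even (weight x) \<and> weight x \<noteq> 2)"
    using subspace_expand [OF assms(1)] by (auto simp: quad_code_iff expand_def)
  also have "\<dots> \<longleftrightarrow> (\<forall>v\<in>U. mem 9 quad_trie v)"
    using assms(2) mem_quad_trie by (fastforce simp: expand_def)
  also have "\<dots> \<longleftrightarrow> U - {0} \<subseteq> {v. mem 9 quad_trie v}"
    using zero_in_quad_trie by blast
  finally show ?thesis .
qed

abbreviation good_words :: "(nat \<Rightarrow> bit) set" where
  "good_words \<equiv> {v. mem 9 quad_trie v}"

lemma C_s_subset_expand: "0 \<in> U \<Longrightarrow> C_s \<subseteq> expand U"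
  by (auto simp: C_s_eq expand_def)

text \<open>The correspondence theorem for \<open>reduce\<close>, whose kernel \<open>C_s\<close>
  has dimension 7, restricted to subspaces of admissible words.\<close>

lemma bij_betw_expand:
  "bij_betw expand (subspaces_in 9 good_words d)
     {C. quad_code 16 C \<and> C_s \<subseteq> C \<and> Z2v.dim C = d + 7}"
proof (rule bij_betw_byWitness [where f' = "(`) reduce"])
  show "\<forall>U\<in>subspaces_in 9 good_words d. reduce ` expand U = U"
    by (auto simp: subspaces_in_def reduce_image_expand)
  show expand: "\<forall>C\<in>{C. quad_code 16 C \<and> C_s \<subseteq> C \<and> Z2v.dim C = d + 7}. expand (reduce ` C) = C"
    using expand_reduce_image unfolding quad_code_iff by blast
  show "expand ` subspaces_in 9 good_words d \<subseteq> {C. quad_code 16 C \<and> C_s \<subseteq> C \<and> Z2v.dim C = d + 7}"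
    by (auto simp: subspaces_in_def quad_code_expand_iff dim_expand
        intro!: subsetD [OF C_s_subset_expand [OF zero_subspace]])
  show "(`) reduce ` {C. quad_code 16 C \<and> C_s \<subseteq> C \<and> Z2v.dim C = d + 7} \<subseteq> subspaces_in 9 good_words d"
  proof clarify
    fix C assume C: "quad_code 16 C" "C_s \<subseteq> C" "Z2v.dim C = d + 7"
    then have U: "Z2v.subspace (reduce ` C)" "reduce ` C \<subseteq> Z2_pow 9"
      by (auto simp: quad_code_iff subspace_reduce_image reduce_in_Z2_pow)
    moreover have "expand (reduce ` C) = C"
      using expand C by blast
    ultimately show "reduce ` C \<in> subspaces_in 9 good_words d"
      using quad_code_expand_iff [OF U] dim_expand [OF U] C by (simp add: subspaces_in_def)
  qed
qed

section \<open>Counts and dimension bounds above \<open>C_s\<close>\<close>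

lemma card_subspaces_in_flags:
  "int (card (subspaces_in 9 good_words d)) * 2 ^ (d choose 2) = flags d quad_trie"
  by (rule flags_correct [OF full_depth_quad_trie])

lemma num_above_C_s: "int (num_quad_codes_above C_s (d + 7)) * 2 ^ (d choose 2) = flags d quad_trie"
  unfolding num_quad_codes_above_def
  using bij_betw_same_card [OF bij_betw_expand [of d]] card_subspaces_in_flags [of d] by simp

text \<open>In dimensions 2, 3, 4 the values carry the weights 2, 8, 64 and so stand for 2531, 2823
  and 112 subspaces; the value 0 yields the upper bound on the dimension.\<close>

lemma flags_quad_trie:
  "flags 1 quad_trie = 159" "flags 2 quad_trie = 5062" "flags 3 quad_trie = 22584"
  "flags 4 quad_trie = 7168" "flags 5 quad_trie = 0"
  by code_simp+

lemma num_above_C_s_values: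
  "num_quad_codes_above C_s 7 = 1" "num_quad_codes_above C_s 8 = 159"
  "num_quad_codes_above C_s 9 = 2531" "num_quad_codes_above C_s 10 = 2823"
  "num_quad_codes_above C_s 11 = 112"
  using num_above_C_s [of 0] num_above_C_s [of 1] num_above_C_s [of 2] num_above_C_s [of 3]
    num_above_C_s [of 4] flags_quad_trie
  by (simp_all add: choose_two)

text \<open>Any \<open>d\<close> vectors of a basis of \<open>U\<close> span such a subspace.
  Absence in one dimension thus rules out all higher ones.\<close>

lemma subspaces_in_nonempty_mono:
  assumes "U \<in> subspaces_in n G k" "d \<le> k"
  shows "subspaces_in n G d \<noteq> {}"
proof -
  have U: "Z2v.subspace U" "U \<subseteq> Z2_pow n" "U - {0} \<subseteq> G" "Z2v.dim U = k"
    using assms(1) by (auto simp: subspaces_in_def)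
  obtain B where B: "B \<subseteq> U" "Z2v.independent B" "card B = k"
    using Z2v.basis_exists U(4) by metis
  then obtain A where A: "A \<subseteq> B" "card A = d"
    using assms(2) obtain_subset_with_card_n by metis
  have "Z2v.span A \<subseteq> U"
    using A(1) B(1) U(1) by (intro Z2v.span_minimal) auto
  moreover have "Z2v.dim (Z2v.span A) = d"
    using A B Z2v.independent_mono Z2v.dim_span_eq_card_independent by blast
  ultimately have "Z2v.span A \<in> subspaces_in n G d"
    using U by (auto simp: subspaces_in_def)
  then show ?thesis
    by blast
qed

lemma dim_above_C_s:
  assumes "quad_code 16 C" "C_s \<subseteq> C"
  shows "7 \<le> Z2v.dim C" "Z2v.dim C \<le> 11"
proof -
  let ?U = "reduce ` C"
  have C: "Z2v.subspace C" "C \<subseteq> Z2_pow 16"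
    using assms(1) by (auto simp: quad_code_iff)
  have U: "Z2v.subspace ?U" "?U \<subseteq> Z2_pow 9"
    by (auto simp: C subspace_reduce_image reduce_in_Z2_pow)
  have eq: "expand ?U = C"
    using expand_reduce_image C assms(2) by blast
  then have dim: "Z2v.dim C = Z2v.dim ?U + 7"
    using dim_expand [OF U] by simp
  then show "7 \<le> Z2v.dim C"
    by simp
  have "card (subspaces_in 9 good_words 5) = 0"
    using card_subspaces_in_flags [of 5] flags_quad_trie by simp
  then have "subspaces_in 9 good_words 5 = {}"
    by simp
  moreover have "?U \<in> subspaces_in 9 good_words (Z2v.dim ?U)"
    using U quad_code_expand_iff [OF U] assms(1) eq by (simp add: subspaces_in_def)
  ultimately have "\<not> 5 \<le> Z2v.dim ?U"
    using subspaces_in_nonempty_mono by blast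
  then show "Z2v.dim C \<le> 11"
    using dim by simp
qed

section \<open>Codes above the magic code\<close>

text \<open>The vectors \<open>u\<close> with last coordinate 0 such that both \<open>u\<close> and
  \<open>u + vec (True # w)\<close> lie in the trie, with that coordinate dropped.\<close>

fun branch_inter :: "bool list \<Rightarrow> trie \<Rightarrow> trie" where
  "branch_inter w (Node a b) = shift_inter w a b"
| "branch_inter w _ = Empty"

text \<open>Prescribing a vector with last coordinate 1 selects a single summand of the recursion,
  so \<open>bij_betw_subspaces_through\<close> applies directly.\<close>

lemma card_subspaces_through:
  assumes t: "full_depth (Suc n) t" "True # w \<in> set (elems t)"
  shows "int (card {U \<in> subspaces_in (Suc n) {v. mem (Suc n) t v} (Suc d). vec (True # w) \<in> U})
           * 2 ^ (d choose 2) = flags d (branch_inter w t)"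
proof -
  let ?G = "{v. mem (Suc n) t v}" and ?v = "vec (True # w)"
  have w: "length w = n" "?v \<in> ?G"
    using elems_spec [OF t(1)] t(2) by auto
  obtain a b where ab: "t = Node a b" "full_depth n a" "full_depth n b"
    using t by (cases t) auto
  have "card {U \<in> subspaces_in (Suc n) ?G (Suc d). ?v \<in> U} =
      card (subspaces_in n (?G \<inter> {u. u + ?v \<in> ?G}) d)"
    using bij_betw_same_card [OF bij_betw_subspaces_through [of ?v n ?G d]] w
      vec_in_Z2_pow [of "True # w"] by simp
  moreover have "subspaces_in n (?G \<inter> {u. u + ?v \<in> ?G}) d =
      subspaces_in n {u. mem n (branch_inter w t) u} d"
  proof (rule subspaces_in_cong)
    have low: "mem n b (u + ?v) = mem n b (u + vec w)" for u
      by (rule mem_cong) (simp add: w(1))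
    have "mem (Suc n) t (u + ?v) = mem n b (u + vec w)" "mem (Suc n) t u = mem n a u"
      if "u \<in> Z2_pow n" for u
    proof -
      have "u n = 0" "?v n = 1"
        using that w(1) by (simp_all add: Z2_pow_def)
      then show "mem (Suc n) t (u + ?v) = mem n b (u + vec w)" "mem (Suc n) t u = mem n a u"
        unfolding ab(1) mem.simps low by simp_all
    qed
    moreover have "mem n (branch_inter w t) u \<longleftrightarrow> mem n a u \<and> mem n b (u + vec w)" for u
      using shift_inter_spec [OF ab(2,3) w(1)] unfolding ab(1) branch_inter.simps by blast
    ultimately show "?G \<inter> {u. u + ?v \<in> ?G} \<inter> Z2_pow n = {u. mem n (branch_inter w t) u} \<inter> Z2_pow n"
      by blast
  qed
  moreover have "full_depth n (branch_inter w t)"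
    using shift_inter_spec [OF ab(2,3) w(1)] by (simp add: ab(1))
  ultimately show ?thesis
    using flags_correct [of n "branch_inter w t" d] by (simp only:)
qed

text \<open>The common reduction of both diagonals. Its head, which is the last coordinate, is 1, as
  \<open>card_subspaces_through\<close> requires, and is split off for that reason.\<close>

abbreviation reduced_diagonal :: "bool list" where
  "reduced_diagonal \<equiv> True # [True, False, True, False, True, False, True, True]"

lemma reduce_diagonal_words:
  assumes "x \<in> diagonal_words"
  shows "reduce x = vec reduced_diagonal"
proof -
  have "vec reduced_diagonal \<in> Z2_pow 9"
    using vec_in_Z2_pow [of reduced_diagonal] by (simp add: numeral_eq_Suc del: vec.simps)
  with assms show ?thesis
    unfolding word_eq_iff [OF reduce_in_Z2_pow \<open>vec reduced_diagonal \<in> Z2_pow 9\<close>] less_9_cases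
    by (auto simp: diagonal_words_def reduce_def word_def)
qed

lemma diagonal_words_nonempty: "\<exists>x \<in> diagonal_words. x \<in> Z2_pow 16"
  by (auto simp: diagonal_words_def intro!: word_in_Z2_pow)

lemma diagonal_words_subset: "diagonal_words \<subseteq> Z2_pow 16"
  by (auto simp: diagonal_words_def intro!: word_in_Z2_pow)

text \<open>\<open>expand U\<close> is a subspace containing \<open>C_s\<close>, so only the
  diagonal words have to be tested, and both have the same reduction.\<close>

lemma C_m_subset_expand_iff:
  assumes "Z2v.subspace U"
  shows "C_m \<subseteq> expand U \<longleftrightarrow> vec reduced_diagonal \<in> U"
proof -
  have "C_m \<subseteq> expand U \<longleftrightarrow> C_s \<union> diagonal_words \<subseteq> expand U"
    unfolding C_m_def
    using Z2v.span_minimal [OF _ subspace_expand [OF assms]] Z2v.span_superset by blast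
  also have "\<dots> \<longleftrightarrow> diagonal_words \<subseteq> expand U"
    using C_s_subset_expand [OF zero_subspace [OF assms]] by blast
  also have "\<dots> \<longleftrightarrow> vec reduced_diagonal \<in> U"
    using reduce_diagonal_words diagonal_words_subset diagonal_words_nonempty
    by (auto simp: expand_def)
  finally show ?thesis .
qed

lemma C_s_subset_C_m: "C_s \<subseteq> C_m"
  unfolding C_m_def using Z2v.span_superset by blast

lemma diagonal_in_quad_trie: "reduced_diagonal \<in> set (elems quad_trie)"
  by code_simp

lemma num_above_C_m:
  "int (num_quad_codes_above C_m (d + 8)) * 2 ^ (d choose 2) =
     flags d (branch_inter (tl reduced_diagonal) quad_trie)"
proof -
  have "bij_betw expand {U \<in> subspaces_in 9 good_words (Suc d). vec reduced_diagonal \<in> U}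
      {C. quad_code 16 C \<and> C_m \<subseteq> C \<and> Z2v.dim C = d + 8}"
  \<comment> \<open>The correspondence is restricted in dimension \<open>Suc d\<close>: one
    dimension for the diagonal and seven for \<open>C_s\<close> make up the 8.\<close>
  proof (rule bij_betw_subset [OF bij_betw_expand [of "Suc d"]])
    have "C_m \<subseteq> expand U \<longleftrightarrow> vec reduced_diagonal \<in> U" if "U \<in> subspaces_in 9 good_words (Suc d)" for U
      using that C_m_subset_expand_iff by (simp add: subspaces_in_def)
    then have "expand ` {U \<in> subspaces_in 9 good_words (Suc d). vec reduced_diagonal \<in> U} =
        expand ` {U \<in> subspaces_in 9 good_words (Suc d). C_m \<subseteq> expand U}"
      by auto
    also have "\<dots> = {C \<in> expand ` subspaces_in 9 good_words (Suc d). C_m \<subseteq> C}"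
      by blast
    also have "\<dots> = {C. quad_code 16 C \<and> C_m \<subseteq> C \<and> Z2v.dim C = d + 8}"
      using bij_betw_imp_surj_on [OF bij_betw_expand [of "Suc d"]] C_s_subset_C_m by auto
    finally show "expand ` {U \<in> subspaces_in 9 good_words (Suc d). vec reduced_diagonal \<in> U} =
        {C. quad_code 16 C \<and> C_m \<subseteq> C \<and> Z2v.dim C = d + 8}" .
  qed auto
  from bij_betw_same_card [OF this] show ?thesis
    using card_subspaces_through [of 8 quad_trie "tl reduced_diagonal" d]
      full_depth_quad_trie diagonal_in_quad_trie
    by (simp add: num_quad_codes_above_def)
qed

lemma num_above_C_m_values:
  "num_quad_codes_above C_m 8 = 1" "num_quad_codes_above C_m 9 = 43"
  "num_quad_codes_above C_m 10 = 85" "num_quad_codes_above C_m 11 = 10"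
proof -
  have "flags 1 (branch_inter (tl reduced_diagonal) quad_trie) = 43"
    "flags 2 (branch_inter (tl reduced_diagonal) quad_trie) = 170"
    "flags 3 (branch_inter (tl reduced_diagonal) quad_trie) = 80"
    by code_simp+
  then show "num_quad_codes_above C_m 8 = 1" "num_quad_codes_above C_m 9 = 43"
    "num_quad_codes_above C_m 10 = 85" "num_quad_codes_above C_m 11 = 10"
    using num_above_C_m [of 0] num_above_C_m [of 1] num_above_C_m [of 2] num_above_C_m [of 3]
    by (simp_all add: choose_two)
qed

text \<open>Dimension 7 would force the reduced code to be zero, but it contains the nonzero reduced
  diagonal.\<close>

lemma dim_above_C_m:
  assumes "quad_code 16 C" "C_m \<subseteq> C"
  shows "8 \<le> Z2v.dim C"
proof (rule ccontr)
  assume "\<not> 8 \<le> Z2v.dim C"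
  moreover have C: "C_s \<subseteq> C" "Z2v.subspace C" "C \<subseteq> Z2_pow 16"
    using assms C_s_subset_C_m by (auto simp: quad_code_iff)
  ultimately have dim: "Z2v.dim C = 0 + 7"
    using dim_above_C_s [OF assms(1)] by simp
  then have "C \<in> expand ` subspaces_in 9 good_words 0"
    using bij_betw_imp_surj_on [OF bij_betw_expand [of 0]] assms(1) C(1) by blast
  then have "C = expand {0}"
    by (simp add: subspaces_in_0)
  then have "vec reduced_diagonal = 0"
    using C_m_subset_expand_iff [of "{0}"] assms(2) by simp
  from fun_cong [OF this, of 0] show False
    by simp
qed

section \<open>The strongly magic code\<close>

definition pos_sum :: "(nat \<Rightarrow> bit) \<Rightarrow> (bit \<times> bit) \<times> (bit \<times> bit)" where
  "pos_sum c = (\<Sum>p<16. if c p = 1 then position_vector p else 0)"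

text \<open>This is the extended Hamming code of length 16.\<close>

definition balanced_words :: "(nat \<Rightarrow> bit) set" where
  "balanced_words = {c \<in> Z2_pow 16. even (weight c) \<and> pos_sum c = 0}"

lemma bit_pair_add_self: "(v :: (bit \<times> bit) \<times> (bit \<times> bit)) + v = 0"
  by (cases v) (auto simp: zero_prod_def bit_add_self simp del: add_bit_eq_xor)

lemma bit_pair_add_eq_0: "(v :: (bit \<times> bit) \<times> (bit \<times> bit)) + w = 0 \<longleftrightarrow> v = w"
  by (cases v; cases w) (auto simp: zero_prod_def bit_eq_add_iff simp del: add_bit_eq_xor)

lemma pos_sum_add: "pos_sum (x + y) = pos_sum x + pos_sum y"
  unfolding pos_sum_def sum.distrib [symmetric]
proof (rule sum.cong [OF refl])
  fix p
  show "(if (x + y) p = 1 then position_vector p else 0) =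
      (if x p = 1 then position_vector p else 0) + (if y p = 1 then position_vector p else 0)"
    by (cases "x p"; cases "y p") (simp_all add: bit_pair_add_self)
qed

lemma pos_sum_support:
  assumes "c \<in> Z2_pow 16"
  shows "pos_sum c = (\<Sum>p | c p = 1. position_vector p)"
  unfolding pos_sum_def weight_support [OF assms]
  by (simp add: sum.If_cases Int_def)

lemma even_weight_add:
  assumes "x \<in> Z2_pow n" "y \<in> Z2_pow n" "even (weight x)" "even (weight y)"
  shows "even (weight (x + y))"
  using assms even_weight_iff [OF Z2_pow_add [OF assms(1,2)]]
  by (simp add: even_weight_iff sum.distrib del: add_bit_eq_xor)

lemma subspace_balanced_words: "Z2v.subspace balanced_words"
  unfolding Z2_subspace_iff balanced_words_def
  by (auto simp: pos_sum_add even_weight_add intro: Z2_pow_add)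
     (simp add: pos_sum_def)

lemma distinct_position_vectors: "inj_on position_vector {..<16}"
proof -
  have "distinct (map position_vector [0..<16])"
    by (simp add: upt_rec position_vector_def two_bits_def)
  then show ?thesis
    by (simp add: distinct_map atLeast0LessThan)
qed

lemma UNIV_bit: "(UNIV :: bit set) = {0, 1}"
  using bit.exhaust by auto

text \<open>Injectivity on the 16 positions suffices, as the target has 16 elements.\<close>

lemma position_vector_surj: "\<exists>p<16. position_vector p = v"
proof -
  have U: "(UNIV :: ((bit \<times> bit) \<times> (bit \<times> bit)) set) = ({0, 1} \<times> {0, 1}) \<times> ({0, 1} \<times> {0, 1})"
    using UNIV_bit UNIV_Times_UNIV by metis
  have "finite (UNIV :: ((bit \<times> bit) \<times> (bit \<times> bit)) set)"
    "card (UNIV :: ((bit \<times> bit) \<times> (bit \<times> bit)) set) = 16"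
    unfolding U by simp_all
  then have "position_vector ` {..<16} = UNIV"
    using card_image [OF distinct_position_vectors] by (intro card_subset_eq) auto
  then show ?thesis
    by (metis UNIV_I imageE lessThan_iff)
qed

lemma indicator_eq_1_iff: "(indicator Q p :: bit) = 1 \<longleftrightarrow> p \<in> Q"
  by (simp add: indicator_def)

lemma indicator_quad_balanced:
  assumes "Q \<subseteq> {..<16}" "card Q = 4" "(\<Sum>p\<in>Q. position_vector p) = 0"
  shows "indicator Q \<in> balanced_words"
proof -
  have "(indicator Q :: nat \<Rightarrow> bit) \<in> Z2_pow 16"
    using assms(1) by (auto simp: Z2_pow_def indicator_def)
  then show ?thesis
    using assms(2,3) pos_sum_support
    by (auto simp: balanced_words_def weight_def indicator_eq_1_iff)
qed

text \<open>A word of weight 2 with zero position sum would give two positions the same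
  vector.\<close>

lemma quad_code_balanced_words: "quad_code 16 balanced_words"
proof -
  have "weight c \<noteq> 2" if c: "c \<in> balanced_words" for c
  proof
    assume "weight c = 2"
    then obtain p q where pq: "p < q" "q < 16" "c = unit p + unit q"
      using c weight_eq_2_iff [of c 16] by (auto simp: balanced_words_def)
    then have "{i. c i = 1} = {p, q}"
      by (auto simp: unit_def)
    then have "position_vector p + position_vector q = 0"
      using c pos_sum_support [of c] pq(1) by (simp add: balanced_words_def)
    then have "position_vector p = position_vector q"
      by (simp only: bit_pair_add_eq_0)
    then show False
      using inj_onD [OF distinct_position_vectors, of p q] pq by simp
  qed
  then show ?thesis
    using subspace_balanced_words by (auto simp: quad_code_iff balanced_words_def)
qed

lemma C_sm_subset: "C_sm \<subseteq> balanced_words"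
  unfolding C_sm_def
  by (rule Z2v.span_minimal [OF _ subspace_balanced_words]) (auto intro: indicator_quad_balanced)

lemma indicator_quad_in_C_sm:
  assumes "Q \<subseteq> {..<16}" "card Q = 4" "(\<Sum>p\<in>Q. position_vector p) = 0"
  shows "indicator Q \<in> C_sm"
  unfolding C_sm_def using assms by (intro Z2v.span_base) blast

text \<open>Induction on the weight: three positions of the support are completed to a quad, and
  adding its indicator removes these three while toggling only one other position.\<close>

lemma balanced_words_subset: "c \<in> balanced_words \<Longrightarrow> c \<in> C_sm"
proof (induction "weight c" arbitrary: c rule: less_induct)
  case less
  have c: "c \<in> Z2_pow 16"
    using less.prems by (simp add: balanced_words_def)
  show ?case
  proof (cases "c = 0")
    case True
    then show ?thesis
      by (simp add: C_sm_def Z2v.span_zero)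
  next
    case False
    let ?S = "{i. c i = 1}"
    have fin: "finite ?S"
      by (rule finite_support [OF c])
    have sub: "?S \<subseteq> {..<16}"
      using weight_support [OF c] by blast
    have "4 \<le> card ?S"
      using less.prems False quad_code_balanced_words by (auto simp: quad_code_def weight_def)
    then obtain T where T: "T \<subseteq> ?S" "card T = 3"
      using obtain_subset_with_card_n [of 3 ?S] by auto
    then obtain p q r where pqr: "T = {p, q, r}" "p \<noteq> q" "q \<noteq> r" "p \<noteq> r"
      by (auto simp: card_3_iff)
    let ?P = position_vector
    \<comment> \<open>The fourth position of the quad through \<open>p\<close>, \<open>q\<close>,
      \<open>r\<close>; it is new because their position vectors are pairwise distinct.\<close>
    obtain s where s: "s < 16" "?P s = ?P p + ?P q + ?P r"
      using position_vector_surj by blast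
    have lt: "p < 16" "q < 16" "r < 16"
      using T(1) sub by (auto simp: pqr(1))
    have ne: "?P p \<noteq> ?P q" "?P q \<noteq> ?P r" "?P p \<noteq> ?P r"
      using inj_onD [OF distinct_position_vectors] lt pqr by blast+
    have "s \<noteq> p"
    proof
      assume "s = p"
      then have "?P q + ?P r = 0"
        using s(2) by (simp add: add.assoc)
      then show False
        using bit_pair_add_eq_0 ne(2) by blast
    qed
    moreover have "s \<noteq> q"
    proof
      assume "s = q"
      then have "?P q = ?P q + (?P p + ?P r)"
        using s(2) by (simp only: ac_simps)
      then have "?P p + ?P r = 0"
        by (simp only: add_cancel_right_right)
      then show False
        using bit_pair_add_eq_0 ne(3) by blast
    qed
    moreover have "s \<noteq> r"
    proof
      assume "s = r"
      then have "?P p + ?P q = 0"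
        using s(2) by simp
      then show False
        using bit_pair_add_eq_0 ne(1) by blast
    qed
    ultimately have distinct: "s \<notin> T"
      by (auto simp: pqr(1))
    define Q where "Q = insert s T"
    have finT: "finite T"
      by (simp add: pqr(1))
    have Q: "Q \<subseteq> {..<16}" "card Q = 4"
      using s(1) T sub distinct finT by (auto simp: Q_def)
    have "(\<Sum>p\<in>T. ?P p) = ?P s"
      using pqr by (simp add: s(2) add.assoc)
    then have "(\<Sum>p\<in>Q. ?P p) = 0"
      using distinct finT by (simp add: Q_def bit_pair_add_self)
    note q = indicator_quad_in_C_sm [OF Q this] indicator_quad_balanced [OF Q this]
    let ?d = "c + indicator Q"
    have "{i. ?d i = 1} \<subseteq> insert s (?S - T)"
    proof
      fix i assume "i \<in> {i. ?d i = 1}"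
      then show "i \<in> insert s (?S - T)"
        using T(1) by (cases "i \<in> Q") (auto simp: Q_def indicator_def)
    qed
    then have "weight ?d \<le> card (insert s (?S - T))"
      unfolding weight_def using fin by (intro card_mono) auto
    also have "\<dots> \<le> Suc (card (?S - T))"
      by (rule card_insert_le_m1) simp_all
    also have "card (?S - T) = card ?S - 3"
      using T finT by (simp add: card_Diff_subset)
    also have "Suc (card ?S - 3) < weight c"
      using \<open>4 \<le> card ?S\<close> by (simp add: weight_def)
    finally have "weight ?d < weight c" .
    moreover have "?d \<in> balanced_words"
      using less.prems q(2) subspace_balanced_words unfolding Z2_subspace_iff by blast
    ultimately have "?d \<in> C_sm"
      by (rule less.hyps)
    then have "?d + indicator Q \<in> C_sm"
      unfolding C_sm_def by (rule Z2v.span_add) (use q(1) in \<open>simp add: C_sm_def\<close>)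
    moreover have "?d + indicator Q = c"
      by (rule word_add_right_self)
    ultimately show ?thesis
      by (simp only:)
  qed
qed

lemma C_sm_eq: "C_sm = balanced_words"
  using C_sm_subset balanced_words_subset by blast

section \<open>Dimension and maximality of \<open>C_sm\<close>\<close>

lemma pos_sum_generators:
  assumes "x \<in> row_words \<union> column_words"
  shows "pos_sum x = 0"
proof -
  have "pos_sum (word [1,1,1,1, 0,0,0,0, 0,0,0,0, 0,0,0,0]) = 0"
    "pos_sum (word [0,0,0,0, 1,1,1,1, 0,0,0,0, 0,0,0,0]) = 0"
    "pos_sum (word [0,0,0,0, 0,0,0,0, 1,1,1,1, 0,0,0,0]) = 0"
    "pos_sum (word [0,0,0,0, 0,0,0,0, 0,0,0,0, 1,1,1,1]) = 0"
    "pos_sum (word [1,0,0,0, 1,0,0,0, 1,0,0,0, 1,0,0,0]) = 0"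
    "pos_sum (word [0,1,0,0, 0,1,0,0, 0,1,0,0, 0,1,0,0]) = 0"
    "pos_sum (word [0,0,1,0, 0,0,1,0, 0,0,1,0, 0,0,1,0]) = 0"
    "pos_sum (word [0,0,0,1, 0,0,0,1, 0,0,0,1, 0,0,0,1]) = 0"
    unfolding pos_sum_def sum_less_16
    by (simp_all add: word_def position_vector_def two_bits_def zero_prod_def)
  with assms show ?thesis
    unfolding row_words_def column_words_def by blast
qed

lemma C_s_subset_C_sm: "C_s \<subseteq> C_sm"
  unfolding C_sm_eq C_s_def
proof (intro Z2v.span_minimal subspace_balanced_words subsetI)
  fix x assume x: "x \<in> row_words \<union> column_words"
  then have "x \<in> C_s"
    unfolding C_s_def by (rule Z2v.span_base)
  then have "x \<in> Z2_pow 16" "even (weight x)"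
    using sum_reduce [of x] even_weight_iff [of x 16] by (simp_all add: C_s_eq)
  then show "x \<in> balanced_words"
    using pos_sum_generators [OF x] by (simp add: balanced_words_def)
qed

text \<open>Parity and position sum together take at most 2^5 values, so their common kernel has
  dimension at least 16 - 5.\<close>

lemma dim_C_sm_ge: "11 \<le> Z2v.dim C_sm"
proof -
  let ?f = "\<lambda>c. (\<Sum>i<16. c i, pos_sum c)"
  have U: "(UNIV :: (bit \<times> (bit \<times> bit) \<times> (bit \<times> bit)) set) =
      {0, 1} \<times> ({0, 1} \<times> {0, 1}) \<times> ({0, 1} \<times> {0, 1})"
    by (simp only: UNIV_bit [symmetric] UNIV_Times_UNIV)
  have "card (UNIV :: (bit \<times> (bit \<times> bit) \<times> (bit \<times> bit)) set) = 32"
    "finite (UNIV :: (bit \<times> (bit \<times> bit) \<times> (bit \<times> bit)) set)"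
    unfolding U by simp_all
  then have "card (?f ` Z2_pow 16) \<le> 32"
    using card_mono [of UNIV "?f ` Z2_pow 16"] by simp
  moreover have "{c \<in> Z2_pow 16. ?f c = 0} = C_sm"
    by (auto simp: C_sm_eq balanced_words_def even_weight_iff zero_prod_def)
  moreover have "card (Z2_pow 16) = card (?f ` Z2_pow 16) * card {c \<in> Z2_pow 16. ?f c = 0}"
    by (rule card_additive_image [OF subspace_Z2_pow finite_Z2_pow])
      (simp add: sum.distrib pos_sum_add del: add_bit_eq_xor)
  moreover have "card C_sm = 2 ^ Z2v.dim C_sm"
    using card_subspace_of_Z2_pow [of C_sm 16] subspace_balanced_words by (auto simp: C_sm_eq balanced_words_def)
  ultimately have "2 ^ 16 \<le> 32 * (2 :: nat) ^ Z2v.dim C_sm"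
    using mult_le_mono1 [of "card (?f ` Z2_pow 16)" 32 "card C_sm"] by (simp add: card_Z2_pow)
  then have "(2 :: nat) ^ 16 \<le> 2 ^ (5 + Z2v.dim C_sm)"
    by (simp add: power_add)
  then have "16 \<le> 5 + Z2v.dim C_sm"
    by (subst (asm) power_increasing_iff) auto
  then show ?thesis
    by simp
qed

text \<open>The upper bound 11 for codes above \<open>C_s\<close> meets the lower bound for
  \<open>C_sm\<close>, which leaves no room for a larger code.\<close>

lemma quad_code_above_C_sm_iff: "quad_code 16 C \<and> C_sm \<subseteq> C \<longleftrightarrow> C = C_sm"
proof
  assume C: "quad_code 16 C \<and> C_sm \<subseteq> C"
  then have sub: "Z2v.subspace C" "C \<subseteq> Z2_pow 16"
    by (auto simp: quad_code_iff)
  have "card C = 2 ^ Z2v.dim C" "card C_sm = 2 ^ Z2v.dim C_sm"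
    using card_subspace_of_Z2_pow [OF sub] card_subspace_of_Z2_pow [of C_sm 16] subspace_balanced_words
    by (auto simp: C_sm_eq balanced_words_def)
  moreover have "Z2v.dim C \<le> 11"
    using dim_above_C_s(2) C C_s_subset_C_sm by blast
  ultimately have "card C \<le> card C_sm"
    using dim_C_sm_ge by simp
  moreover have "finite C"
    using sub(2) by (rule finite_subset) simp
  ultimately show "C = C_sm"
    using card_seteq [of C C_sm] C by blast
qed (use quad_code_balanced_words in \<open>auto simp: C_sm_eq\<close>)

lemma dim_C_sm: "Z2v.dim C_sm = 11"
  using dim_C_sm_ge dim_above_C_s(2) quad_code_balanced_words C_s_subset_C_sm
  by (simp add: C_sm_eq le_antisym)

section \<open>Realizability\<close>

lemma dim_even_words:
  assumes "0 < l"
  shows "Z2v.dim {c \<in> Z2_pow l. even (weight c)} = l - 1"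
proof -
  let ?E = "{c \<in> Z2_pow l. even (weight c)}"
  let ?f = "\<lambda>c. \<Sum>i<l. c i :: bit"
  have E: "?E = {c \<in> Z2_pow l. ?f c = 0}"
    by (auto simp: even_weight_iff)
  \<comment> \<open>The parity functional is onto because \<open>l > 0\<close> provides the odd word
    \<open>unit 0\<close>.\<close>
  have "?f ` Z2_pow l = {0, 1}"
  proof -
    have "?f (unit 0) = 1"
      using assms by (simp add: unit_def of_bool_def)
    moreover have "?f 0 = 0"
      by simp
    ultimately have "{0, 1} \<subseteq> ?f ` Z2_pow l"
      using unit_in_Z2_pow [OF assms] zero_in_Z2_pow image_eqI [of 1 ?f "unit 0" "Z2_pow l"]
        image_eqI [of 0 ?f 0 "Z2_pow l"] by (simp only: insert_subset empty_subsetI simp_thms)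
    then show ?thesis
      using UNIV_bit by blast
  qed
  then have "2 ^ l = 2 * card ?E"
    using card_additive_image [OF subspace_Z2_pow finite_Z2_pow, of l ?f]
    by (simp add: card_Z2_pow E sum.distrib del: add_bit_eq_xor)
  moreover have "Z2v.subspace ?E"
    unfolding Z2_subspace_iff by (auto intro: Z2_pow_add even_weight_add)
  ultimately have "2 ^ l = (2 :: nat) ^ Suc (Z2v.dim ?E)"
    using card_subspace_of_Z2_pow [of ?E l] by auto
  then have "l = Suc (Z2v.dim ?E)"
    by (subst (asm) power_inject_exp) auto
  then show ?thesis
    by simp
qed

text \<open>The code is the kernel of the map pairing parity with the card sum, whose values lie in
  a group of order 2^(n+1).\<close>

lemma realizable_imp_le:
  assumes "realizable n l C" "Z2v.subspace C" "C \<subseteq> Z2_pow l"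
  shows "l \<le> Suc (n + Z2v.dim C)"
proof -
  obtain as where as: "length as = l" "set as \<subseteq> Z2_pow n" "realized_code as = C"
    using assms(1) by (auto simp: realizable_def deck_def)
  let ?f = "\<lambda>c. (\<Sum>i<l. c i, \<Sum>i<l. scale_Z2 (c i) (as ! i))"
  have ker: "{c \<in> Z2_pow l. ?f c = 0} = C"
    using as(1,3) by (auto simp: realized_code_def even_weight_iff zero_prod_def)
  have "?f ` Z2_pow l \<subseteq> {0, 1} \<times> Z2_pow n"
  proof -
    have "(\<Sum>i<l. scale_Z2 (c i) (as ! i)) \<in> Z2_pow n" for c
      using as(1,2) by (intro Z2v.subspace_sum subspace_Z2_pow scale_in_Z2_pow) auto
    then show ?thesis
      using UNIV_bit by blast
  qed
  then have "card (?f ` Z2_pow l) \<le> card ({0, 1 :: bit} \<times> Z2_pow n)"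
    by (intro card_mono) auto
  also have "\<dots> = 2 ^ Suc n"
    by (simp add: card_cartesian_product card_Z2_pow)
  finally have image: "card (?f ` Z2_pow l) \<le> 2 ^ Suc n" .
  have "card (Z2_pow l) = card (?f ` Z2_pow l) * card {c \<in> Z2_pow l. ?f c = 0}"
    by (rule card_additive_image [OF subspace_Z2_pow finite_Z2_pow])
      (simp add: sum.distrib Z2v.scale_left_distrib del: add_bit_eq_xor)
  then have "2 ^ l \<le> 2 ^ Suc n * (2 :: nat) ^ Z2v.dim C"
    using image card_subspace_of_Z2_pow [OF assms(2,3)] by (simp add: ker card_Z2_pow)
  then have "(2 :: nat) ^ l \<le> 2 ^ (Suc (n + Z2v.dim C))"
    by (simp add: power_add)
  then show ?thesis
    by (subst (asm) power_increasing_iff) auto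
qed

section \<open>Construction of a realizing card sequence\<close>

interpretation Z2_pair: vector_space_pair scale_Z2 scale_Z2 ..

lemma linear_Z2_add: "Vector_Spaces.linear scale_Z2 scale_Z2 f \<Longrightarrow> f (x + y) = f x + f y"
  by (rule Z2_pair.linear_add)

text \<open>On even words the last term vanishes, so translating all arguments by \<open>v\<close>
  does not affect the relations between their images.\<close>

lemma linear_Z2_sum_units:
  assumes "Vector_Spaces.linear scale_Z2 scale_Z2 f" "c \<in> Z2_pow l"
  shows "(\<Sum>i<l. scale_Z2 (c i) (f (unit i + v))) = f c + scale_Z2 (\<Sum>i<l. c i) (f v)"
proof -
  have "c = (\<Sum>i<l. scale_Z2 (c i) (unit i))"
  proof
    fix j
    have "(\<Sum>i<l. scale_Z2 (c i) (unit i)) j = (\<Sum>i<l. scale_Z2 (c i) (unit i) j)"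
      by (induction l) simp_all
    also have "\<dots> = (\<Sum>i<l. if i = j then c i else 0)"
      by (rule sum.cong) (auto simp: scale_Z2_def unit_def)
    also have "\<dots> = c j"
      using assms(2) by (auto simp: Z2_pow_def)
    finally show "c j = (\<Sum>i<l. scale_Z2 (c i) (unit i)) j"
      by simp
  qed
  then have "f c = f (\<Sum>i<l. scale_Z2 (c i) (unit i))"
    by (rule arg_cong)
  then have "f c = (\<Sum>i<l. scale_Z2 (c i) (f (unit i)))"
    unfolding Z2_pair.linear_sum [OF assms(1)] Z2_pair.linear_scale [OF assms(1)] .
  then show ?thesis
    by (simp add: Z2_pair.linear_add [OF assms(1)] Z2v.scale_right_distrib sum.distrib Z2v.scale_sum_left)
qed

text \<open>A basis of \<open>C\<close> is extended to one of \<open>E\<close>; the old vectors go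
  to 0 and the new ones, at most \<open>n\<close> in number, to distinct unit words. That the kernel
  is no larger than \<open>C\<close> follows by counting the image.\<close>

lemma ex_linear_with_kernel:
  assumes "Z2v.subspace C" "Z2v.subspace E" "C \<subseteq> E" "E \<subseteq> Z2_pow l"
    and "Z2v.dim E \<le> n + Z2v.dim C"
  shows "\<exists>f. Vector_Spaces.linear scale_Z2 scale_Z2 f \<and> f ` E \<subseteq> Z2_pow n \<and> {c \<in> E. f c = 0} = C"
proof -
  have finE: "finite E"
    using assms(4) by (rule finite_subset) simp
  obtain B where B: "B \<subseteq> C" "Z2v.independent B" "C \<subseteq> Z2v.span B" "card B = Z2v.dim C"
    using Z2v.basis_exists by blast
  obtain B' where B': "B \<subseteq> B'" "B' \<subseteq> E" "Z2v.independent B'" "E \<subseteq> Z2v.span B'"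
    using Z2v.maximal_independent_subset_extend [of B E] B(1,2) assms(3) by blast
  have finB': "finite B'"
    using B'(2) finE finite_subset by blast
  define D where "D = B' - B"
  have finD: "finite D"
    by (simp add: D_def finB')
  have "Z2v.dim E = card B'"
    using B' by (intro Z2v.dim_unique) auto
  then have cardD: "card D = Z2v.dim E - Z2v.dim C" "Z2v.dim C \<le> Z2v.dim E"
    using card_Diff_subset [OF finite_subset [OF B'(1) finB'] B'(1)] card_mono [OF finB' B'(1)] B(4)
    by (simp_all add: D_def)
  then have "card D \<le> card {..<n}"
    using assms(5) by simp
  then obtain g where g: "inj_on g D" "g ` D \<subseteq> {..<n}"
    using card_le_inj [OF finD, of "{..<n}"] by auto
  obtain f where f: "Vector_Spaces.linear scale_Z2 scale_Z2 f"
    "\<And>b. b \<in> B' \<Longrightarrow> f b = (if b \<in> D then unit (g b) else 0)"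
    using Z2_pair.linear_independent_extend [OF B'(3), of "\<lambda>b. if b \<in> D then unit (g b) else 0"]
    by blast
  have f_0: "f 0 = 0"
    by (rule Z2_pair.linear_0 [OF f(1)])
  have "Z2v.subspace {x. f x \<in> Z2_pow n}" "Z2v.subspace {x. f x = 0}"
    using f_0 by (auto simp: Z2_subspace_iff linear_Z2_add [OF f(1)] Z2_pow_add)
  moreover have "B' \<subseteq> {x. f x \<in> Z2_pow n}"
  proof clarify
    fix b assume "b \<in> B'"
    then show "f b \<in> Z2_pow n"
      using g(2) by (cases "b \<in> D") (auto simp: f(2) intro!: unit_in_Z2_pow)
  qed
  moreover have "B \<subseteq> {x. f x = 0}"
    using B'(1) f(2) by (auto simp: D_def)
  ultimately have "Z2v.span B' \<subseteq> {x. f x \<in> Z2_pow n}" "Z2v.span B \<subseteq> {x. f x = 0}"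
    using Z2v.span_minimal by blast+
  then have image: "f ` E \<subseteq> Z2_pow n" and ker: "C \<subseteq> {c \<in> E. f c = 0}"
    using B'(4) B(3) assms(3) by blast+
  have finK: "finite {c \<in> E. f c = 0}"
    using finE by simp
  \<comment> \<open>Coordinate \<open>g b\<close> of the image of a subset sum tells whether
    \<open>b\<close> was taken, so distinct subsets of \<open>D\<close> have distinct
    images.\<close>
  have sums: "\<Sum>A \<in> E" "f (\<Sum>A) (g b) = of_bool (b \<in> A)" if "A \<subseteq> D" "b \<in> D" for A b
  proof -
    have A: "A \<subseteq> B'"
      using that(1) by (auto simp: D_def)
    then show "\<Sum>A \<in> E"
      using B'(2) by (intro Z2v.subspace_sum assms(2)) auto
    have "f (\<Sum>A) = (\<Sum>a\<in>A. unit (g a))"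
      unfolding Z2_pair.linear_sum [OF f(1)]
      by (intro sum.cong refl) (use A that(1) f(2) in \<open>simp add: subset_iff\<close>)
    moreover have "finite A"
      using that(1) finD finite_subset by blast
    then have "(\<Sum>a\<in>A. unit (g a)) i = (\<Sum>a\<in>A. unit (g a) i)" for i
      by (induction A rule: finite_induct) simp_all
    moreover have "(\<Sum>a\<in>A. unit (g a) (g b)) = (\<Sum>a\<in>A. if a = b then 1 else 0)"
      using g(1) that by (intro sum.cong) (auto simp: unit_def inj_on_def)
    ultimately show "f (\<Sum>A) (g b) = of_bool (b \<in> A)"
      using \<open>finite A\<close> by simp
  qed
  have "inj_on (\<lambda>A. f (\<Sum>A)) (Pow D)"
  proof (rule inj_onI)
    fix A A' assume "A \<in> Pow D" "A' \<in> Pow D" "f (\<Sum>A) = f (\<Sum>A')"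
    then have "b \<in> A \<longleftrightarrow> b \<in> A'" if "b \<in> D" for b
      using sums(2) [of A b] sums(2) [of A' b] that by (cases "b \<in> A"; cases "b \<in> A'") simp_all
    then show "A = A'"
      using \<open>A \<in> Pow D\<close> \<open>A' \<in> Pow D\<close> by blast
  qed
  moreover have "(\<lambda>A. f (\<Sum>A)) ` Pow D \<subseteq> f ` E"
  \<comment> \<open>\<open>sums\<close> presupposes an element of \<open>D\<close>, so empty
    \<open>D\<close> is treated apart.\<close>
  proof (cases "D = {}")
    case True
    then show ?thesis
      using zero_subspace [OF assms(2)] by auto
  qed (use sums(1) in blast)
  ultimately have "2 ^ card D \<le> card (f ` E)"
    using card_inj_on_le [of "\<lambda>A. f (\<Sum>A)" "Pow D" "f ` E"] finE by (simp add: card_Pow finD)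
  moreover have "card E = card (f ` E) * card {c \<in> E. f c = 0}"
    by (rule card_additive_image [OF assms(2) finE linear_Z2_add [OF f(1)]])
  moreover have "card E = 2 ^ card D * card C"
    using cardD card_subspace_of_Z2_pow [OF assms(2,4)] card_subspace_of_Z2_pow [OF assms(1), of l] assms(3,4)
    by (simp flip: power_add)
  ultimately have "2 ^ card D * card {c \<in> E. f c = 0} \<le> 2 ^ card D * card C"
    by simp
  then have "card {c \<in> E. f c = 0} \<le> card C"
    by simp
  then have "{c \<in> E. f c = 0} = C"
    using card_seteq [OF finK ker] by simp
  with f(1) image show ?thesis
    by blast
qed

text \<open>With \<open>C\<close> as the kernel of a linear map on the even words, two equal cards
  would put a word \<open>unit i + unit j\<close> of weight 2 into \<open>C\<close>.\<close>

lemma quad_code_realizable: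
  assumes C: "quad_code l C" and l: "0 < l" and n: "l \<le> Suc (n + Z2v.dim C)"
  shows "realizable n l C"
proof -
  let ?E = "{c \<in> Z2_pow l. even (weight c)}"
  have sub: "Z2v.subspace C" "C \<subseteq> ?E"
    using C by (auto simp: quad_code_iff)
  have E: "Z2v.subspace ?E"
    unfolding Z2_subspace_iff by (auto intro: Z2_pow_add even_weight_add)
  have "Z2v.dim ?E \<le> n + Z2v.dim C"
    unfolding dim_even_words [OF l] using n by simp
  moreover have "?E \<subseteq> Z2_pow l"
    by blast
  ultimately obtain f where
    f: "Vector_Spaces.linear scale_Z2 scale_Z2 f" "f ` ?E \<subseteq> Z2_pow n" "{c \<in> ?E. f c = 0} = C"
    using ex_linear_with_kernel [OF sub(1) E sub(2), of l n] by blast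
  \<comment> \<open>Adding \<open>unit 0\<close> makes the arguments even, which puts the cards into
    \<open>Z2_pow n\<close>; the first card is 0.\<close>
  define as where "as = map (\<lambda>i. f (unit i + unit 0)) [0..<l]"
  have pair: "unit i + unit j \<in> ?E" if "i < l" "j < l" for i j
  proof -
    have "even (weight (unit i + unit j))"
    proof (cases "i = j")
      case False
      then have "unit i + unit j = unit (min i j) + unit (max i j)" "min i j < max i j" "max i j < l"
        using that by (auto simp: min_def max_def add.commute)
      then have "weight (unit i + unit j) = 2"
        using weight_eq_2_iff [OF Z2_pow_add [OF unit_in_Z2_pow [OF that(1)] unit_in_Z2_pow [OF that(2)]]]
        by blast
      then show ?thesis
        by simp
    qed simp
    then show ?thesis
      using that by (simp add: Z2_pow_add unit_in_Z2_pow)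
  qed
  have "set as \<subseteq> deck n"
    using f(2) pair l by (auto simp: as_def deck_def)
  moreover have "distinct as"
  proof -
    have "f (unit i + unit 0) \<noteq> f (unit j + unit 0)" if "i < j" "j < l" for i j
    proof
      assume "f (unit i + unit 0) = f (unit j + unit 0)"
      then have "f ((unit i + unit 0) + (unit j + unit 0)) = 0"
        unfolding linear_Z2_add [OF f(1), of "unit i + unit 0" "unit j + unit 0"]
        by (simp only: word_add_self)
      moreover have "(unit i + unit 0) + (unit j + unit 0) = unit i + unit j"
        by (simp only: ac_simps word_add_left_self word_add_self add_0_right)
      ultimately have "unit i + unit j \<in> C"
        using pair [of i j] that f(3) by auto
      moreover have "weight (unit i + unit j) = 2"
        using weight_eq_2_iff [of "unit i + unit j" l] pair [of i j] that by fastforce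
      ultimately show False
        using C by (auto simp: quad_code_iff)
    qed
    then show ?thesis
      by (auto simp: as_def distinct_map inj_on_def) (metis linorder_neqE_nat)
  qed
  moreover have "realized_code as = C"
  proof -
    \<comment> \<open>For even \<open>c\<close> the coordinate sum is 0, so the translation by
      \<open>unit 0\<close> drops out.\<close>
    have "(\<Sum>i<l. scale_Z2 (c i) (as ! i)) = f c" if "c \<in> ?E" for c
      using linear_Z2_sum_units [OF f(1), of c l "unit 0"] even_weight_iff [of c l] that
      by (simp add: as_def)
    then show ?thesis
      using f(3) by (auto simp: realized_code_def as_def)
  qed
  moreover have "length as = l"
    by (simp add: as_def)
  ultimately show ?thesis
    unfolding realizable_def by blast
qed

lemma quad_code_realizable_iff:
  assumes "quad_code l C" "0 < l"
  shows "realizable n l C \<longleftrightarrow> l \<le> Suc (n + Z2v.dim C)"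
  using quad_code_realizable [OF assms] realizable_imp_le [of n l C] assms(1)
  by (auto simp: quad_code_iff)

text \<open>Deck sizes \<open>2 ^ n\<close> grow with \<open>n\<close>, so the least size comes from
  the least \<open>n\<close>.\<close>

lemma smallest_deck_size_eq:
  assumes "\<And>n. realizable n l C \<longleftrightarrow> m \<le> n"
  shows "smallest_deck_size l C = 2 ^ m"
  unfolding smallest_deck_size_def
  by (rule Least_equality) (auto simp: deck_def card_Z2_pow assms)

theorem theorem12:
  shows
    "((\<forall>C. quad_code 16 C \<and> C_s \<subseteq> C \<longrightarrow> 7 \<le> Z2v.dim C \<and> Z2v.dim C \<le> 11) \<and>
      num_quad_codes_above C_s 7 = 1 \<and>
      num_quad_codes_above C_s 8 = 159 \<and>
      num_quad_codes_above C_s 9 = 2531 \<and>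
      num_quad_codes_above C_s 10 = 2823 \<and>
      num_quad_codes_above C_s 11 = 112) \<and>
     ((\<forall>C. quad_code 16 C \<and> C_m \<subseteq> C \<longrightarrow> 8 \<le> Z2v.dim C \<and> Z2v.dim C \<le> 11) \<and>
      num_quad_codes_above C_m 8 = 1 \<and>
      num_quad_codes_above C_m 9 = 43 \<and>
      num_quad_codes_above C_m 10 = 85 \<and>
      num_quad_codes_above C_m 11 = 10) \<and>
     ((\<exists>!C. quad_code 16 C \<and> C_sm \<subseteq> C) \<and>
      (\<forall>C. quad_code 16 C \<and> C_sm \<subseteq> C \<longrightarrow> Z2v.dim C = 11)) \<and>
     (\<forall>C k. quad_code 16 C \<and> (C_s \<subseteq> C \<or> C_m \<subseteq> C \<or> C_sm \<subseteq> C) \<and>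
            Z2v.dim C = k \<and> k \<in> {7, 8, 9, 10, 11} \<longrightarrow>
        (\<forall>n. realizable n 16 C \<longleftrightarrow> n \<ge> 15 - k) \<and>
        (k = 7 \<longrightarrow> smallest_deck_size 16 C = 256) \<and>
        (k = 8 \<longrightarrow> smallest_deck_size 16 C = 128) \<and>
        (k = 9 \<longrightarrow> smallest_deck_size 16 C = 64) \<and>
        (k = 10 \<longrightarrow> smallest_deck_size 16 C = 32) \<and>
        (k = 11 \<longrightarrow> smallest_deck_size 16 C = 16))"
proof -
  have realization: "(\<forall>n. realizable n 16 C \<longleftrightarrow> n \<ge> 15 - k) \<and>
      (k = 7 \<longrightarrow> smallest_deck_size 16 C = 256) \<and>
      (k = 8 \<longrightarrow> smallest_deck_size 16 C = 128) \<and>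
      (k = 9 \<longrightarrow> smallest_deck_size 16 C = 64) \<and>
      (k = 10 \<longrightarrow> smallest_deck_size 16 C = 32) \<and>
      (k = 11 \<longrightarrow> smallest_deck_size 16 C = 16)"
    if "quad_code 16 C" "Z2v.dim C = k" for C k
  proof -
    \<comment> \<open>\<open>16 \<le> Suc (n + k)\<close> is equivalent to
      \<open>15 - k \<le> n\<close>, even where the subtraction truncates.\<close>
    have "realizable n 16 C \<longleftrightarrow> 15 - k \<le> n" for n
      using quad_code_realizable_iff [OF that(1), of n] that(2) by auto
    then show ?thesis
      using smallest_deck_size_eq [of 16 C "15 - k"] by auto
  qed
  show ?thesis
  proof (intro conjI)
    show "\<forall>C. quad_code 16 C \<and> C_s \<subseteq> C \<longrightarrow> 7 \<le> Z2v.dim C \<and> Z2v.dim C \<le> 11"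
      using dim_above_C_s by blast
    show "\<forall>C. quad_code 16 C \<and> C_m \<subseteq> C \<longrightarrow> 8 \<le> Z2v.dim C \<and> Z2v.dim C \<le> 11"
      using dim_above_C_m dim_above_C_s(2) C_s_subset_C_m by blast
    show "\<exists>!C. quad_code 16 C \<and> C_sm \<subseteq> C"
      unfolding quad_code_above_C_sm_iff by blast
    show "\<forall>C. quad_code 16 C \<and> C_sm \<subseteq> C \<longrightarrow> Z2v.dim C = 11"
      unfolding quad_code_above_C_sm_iff using dim_C_sm by blast
  qed (use realization in \<open>simp_all add: num_above_C_s_values num_above_C_m_values\<close>)
qed

end
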